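(* Let $f_L(v)=-\sin(2\pi(v-L))-\sin(2\pi L)$ for $v\in\mathbb{R}$. There exists a constant $\alpha^*$ such that for all $\alpha_0\ge\alpha^*$ there exist a unique real $c$ and two functions $\phi_1:\mathbb{R}\to\mathbb{R}$ and $\phi_2:\mathbb{R}\to\mathbb{R}$ that satisfy $$\begin{cases} c\,\phi_1'(z)=\alpha_0(\phi_2(z)-\phi_1(z)),\\ c\,\phi_2'(z)=2(\phi_1(z+1)+\phi_1(z-1)-2\phi_1(z))+2f_L(\phi_1(z))+\alpha_0(\phi_1(z)-\phi_2(z)),\\ \phi_1,\ \phi_2\ \text{are non-decreasing over }\mathbb{R},\\ \phi_1(-\infty)=0,\quad \phi_1(+\infty)=1,\\ \phi_2(-\infty)=0,\quad \phi_2(+\infty)=1, \end{cases}$$ in the classical sense if $c\ne0$ and almost everywhere if $c=0$. Moreover, if $c\neq 0$, then the two profiles $\phi_1,\phi_2$ are unique up to translation.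
   Context: Here $\phi_i(\pm\infty)$ denotes $\lim_{z\to\pm\infty}\phi_i(z)$. The constant $\alpha_0>0$ is $\frac{1}{2m_0}$, where $m_0>0$ is the mass of the particles in the Frenkel-Kontorova chain, and $L$ is a real parameter ($-\sin(2\pi L)$ is the constant driving force). The constant $\alpha^*$ is made precise by the monotonicity condition $2\frac{\partial F}{\partial X_0}+\alpha_0>0$ for the nonlinearity $F(X_0,X_1,X_2)=X_1+X_2-2X_0+f_L(X_0)$ on $[0,1]^3$.
   Formalization: L is restricted to cos(2πL)>0 (L in (-1/4,1/4) modulo 1), where f_L is bistable between 0 and 1; for arbitrary real L the claim is false: at L=1/2, f_L(v)=sin(2πv) and no c, φ_1, φ_2 exist for any α_0>0. *)

theory Defs
  imports "HOL-Analysis.Analysis"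
begin

(* The zeros modulo 1 are 0 and 1/2 + 2 L, and the derivative at 0 is - 2 pi cos (2 pi L).  Hence
   0 and 1 are stable and separated by a single unstable zero exactly when cos (2 pi L) > 0,
   i.e. when L lies in (-1/4, 1/4) modulo 1. *)
definition f_L :: "real \<Rightarrow> real \<Rightarrow> real" where
  "f_L L v = - sin (2 * pi * (v - L)) - sin (2 * pi * L)"

definition FK_nonlinearity :: "real \<Rightarrow> real \<Rightarrow> real \<Rightarrow> real \<Rightarrow> real" where
  "FK_nonlinearity L X0 X1 X2 = X1 + X2 - 2 * X0 + f_L L X0"

(* The formula for F is smooth on all of R^3, so the partial derivative at boundary points of
   the cube can be taken two-sided. *)
definition monotonicity_condition :: "real \<Rightarrow> real \<Rightarrow> bool" where
  "monotonicity_condition L \<alpha>\<^sub>0 \<longleftrightarrow>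
     (\<forall>X0\<in>{0..1}. \<forall>X1\<in>{0..1}. \<forall>X2\<in>{0..1}.
        2 * deriv (\<lambda>x. FK_nonlinearity L x X1 X2) X0 + \<alpha>\<^sub>0 > 0)"

definition wave_equations ::
  "real \<Rightarrow> real \<Rightarrow> real \<Rightarrow> (real \<Rightarrow> real) \<Rightarrow> (real \<Rightarrow> real) \<Rightarrow> real \<Rightarrow> bool" where
  "wave_equations L \<alpha>\<^sub>0 c \<phi>\<^sub>1 \<phi>\<^sub>2 z \<longleftrightarrow>
     c * deriv \<phi>\<^sub>1 z = \<alpha>\<^sub>0 * (\<phi>\<^sub>2 z - \<phi>\<^sub>1 z) \<and>
     c * deriv \<phi>\<^sub>2 z =
       2 * (\<phi>\<^sub>1 (z + 1) + \<phi>\<^sub>1 (z - 1) - 2 * \<phi>\<^sub>1 z) + 2 * f_L L (\<phi>\<^sub>1 z) + \<alpha>\<^sub>0 * (\<phi>\<^sub>1 z - \<phi>\<^sub>2 z)"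

(* For c = 0 the derivative terms vanish whatever value deriv takes, so no differentiability is
   asked for there.  For c \<noteq> 0, differentiability everywhere together with the equations
   already makes both profiles continuously differentiable. *)
definition traveling_wave ::
  "real \<Rightarrow> real \<Rightarrow> real \<Rightarrow> (real \<Rightarrow> real) \<Rightarrow> (real \<Rightarrow> real) \<Rightarrow> bool" where
  "traveling_wave L \<alpha>\<^sub>0 c \<phi>\<^sub>1 \<phi>\<^sub>2 \<longleftrightarrow>
     (if c \<noteq> 0
      then \<forall>z. \<phi>\<^sub>1 field_differentiable (at z) \<and> \<phi>\<^sub>2 field_differentiable (at z) \<and>
               wave_equations L \<alpha>\<^sub>0 c \<phi>\<^sub>1 \<phi>\<^sub>2 z
      else AE z in lebesgue. wave_equations L \<alpha>\<^sub>0 c \<phi>\<^sub>1 \<phi>\<^sub>2 z) \<and>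
     mono \<phi>\<^sub>1 \<and> mono \<phi>\<^sub>2 \<and>
     (\<phi>\<^sub>1 \<longlongrightarrow> 0) at_bot \<and> (\<phi>\<^sub>1 \<longlongrightarrow> 1) at_top \<and>
     (\<phi>\<^sub>2 \<longlongrightarrow> 0) at_bot \<and> (\<phi>\<^sub>2 \<longlongrightarrow> 1) at_top"

end

theory Submission
  imports Defs "HOL-Probability.Probability"
begin

text \<open>Write \<open>\<phi>\<^sub>1 = S c \<phi>\<^sub>2\<close> and \<open>\<phi>\<^sub>2 = S c (N \<phi>\<^sub>1)\<close>, where \<open>S c\<close> averages along \<open>z - c s\<close> with
  \<open>s\<close> exponentially distributed: the system becomes the fixed point equation \<open>\<phi>\<^sub>1 = T c \<phi>\<^sub>1\<close> of an
  operator that preserves order for large \<open>\<alpha>\<close> and makes sense for every \<open>c\<close>, with \<open>S 0 = id\<close>.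

  Existence: solve the equation on \<open>[p, q)\<close> with value \<open>0\<close> to the left and \<open>1\<close> to the right.  Limits
  of such solutions (Helly) connect zeros of \<open>f\<close>.  For \<open>c \<ge> 0\<close> a connection from \<open>0\<close> to the
  unstable zero \<open>\<theta>\<close> would satisfy \<open>\<phi> \<le> T c \<phi> \<le> T 0 \<phi>\<close>, hence be bounded and convex along
  \<open>z + \<int>\<close>, which is absurd; for \<open>c \<le> 0\<close> the same applies from \<open>\<theta>\<close> to \<open>1\<close>.  So every speed admits
  a front on the line, a front stuck at the left end, or a front stuck at the right end.  If the first
  case never occurred, the other two would split \<open>\<real>\<close> into two closed sets, disjoint because a left
  and a right front of equal speed enclose a full one, and neither exhausting \<open>\<real>\<close>.

  Uniqueness: slide a subsolution under a supersolution; near \<open>0\<close> and \<open>1\<close> the operator contracts, and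
  at contact the strong maximum principle gives equality.  Two waves of different speeds are compared at
  a nonzero speed strictly between them, where \<open>T c\<close> smooths even a discontinuous standing wave.\<close>

subsection \<open>Profiles and exponential averages\<close>

text \<open>No limits at infinity are prescribed, so the class is closed under translation,
  averaging, truncation and monotone pointwise limits; the limits 0 and 1 are imposed
  separately.\<close>

definition profile :: "(real \<Rightarrow> real) \<Rightarrow> bool" where
  "profile g \<longleftrightarrow> mono g \<and> (\<forall>z. 0 \<le> g z \<and> g z \<le> 1)"

lemma profileI: "mono g \<Longrightarrow> (\<And>z. 0 \<le> g z) \<Longrightarrow> (\<And>z. g z \<le> 1) \<Longrightarrow> profile g"
  by (auto simp: profile_def)

lemma profileD:
  assumes "profile g"
  shows "mono g" "x \<le> y \<Longrightarrow> g x \<le> g y" "0 \<le> g z" "g z \<le> 1"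
  using assms by (auto simp: profile_def mono_def)

lemma profile_measurable [measurable_dest]: "profile g \<Longrightarrow> g \<in> borel_measurable borel"
  by (auto simp: profile_def intro: borel_measurable_mono)

lemma profile_shift: "profile g \<Longrightarrow> profile (\<lambda>z. g (z + s))"
  by (auto simp: profile_def mono_def)

lemma profile_discont: "profile g \<Longrightarrow> countable {z. \<not> isCont g z}"
  using mono_ctble_discont[of g] by (auto simp: profile_def)

lemma countable_dense:
  fixes X :: "real set"
  assumes "countable X" "a < b"
  obtains y where "a < y" "y < b" "y \<notin> X"
proof -
  have "uncountable {a<..<b}" using assms by (simp add: uncountable_open_interval)
  then have "\<not> {a<..<b} \<subseteq> X" using assms countable_subset by blast
  then obtain y where "y \<in> {a<..<b}" "y \<notin> X" by blast
  then show ?thesis using that by auto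
qed

lemma profile_lim_at_top:
  assumes "profile g" obtains l where "(g \<longlongrightarrow> l) at_top" "\<And>z. g z \<le> l" "l \<le> 1" "0 \<le> l"
proof -
  have bdd: "bdd_above (range g)" using profileD[OF assms] by (auto intro!: bdd_aboveI[of _ 1])
  let ?l = "SUP z. g z"
  have le: "g z \<le> ?l" for z using bdd by (simp add: cSUP_upper)
  have "(g \<longlongrightarrow> ?l) at_top"
  proof (rule order_tendstoI)
    fix a assume "a < ?l"
    then obtain z where "a < g z" using bdd by (auto simp: less_cSUP_iff)
    show "\<forall>\<^sub>F x in at_top. a < g x"
      using eventually_ge_at_top[of z]
      by eventually_elim (rule less_le_trans[OF \<open>a < g z\<close> profileD(2)[OF assms]])
  next
    fix a assume "?l < a" then show "\<forall>\<^sub>F x in at_top. g x < a"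
      by (intro always_eventually allI le_less_trans[OF le])
  qed
  moreover have "?l \<le> 1" using profileD(4)[OF assms] by (auto intro: cSUP_least)
  ultimately show ?thesis using that[of ?l] le order_trans[OF profileD(3)[OF assms] le[of 0]] by blast
qed

lemma profile_lim_at_bot:
  assumes "profile g" obtains l where "(g \<longlongrightarrow> l) at_bot" "\<And>z. l \<le> g z" "0 \<le> l" "l \<le> 1"
proof -
  have "profile (\<lambda>z. 1 - g (- z))" using assms by (auto simp: profile_def mono_def)
  from profile_lim_at_top[OF this] obtain l
    where l: "((\<lambda>z. 1 - g (- z)) \<longlongrightarrow> l) at_top" "\<And>z. 1 - g (- z) \<le> l" "l \<le> 1" "0 \<le> l" by blast
  have "((\<lambda>z. 1 - (1 - g (- z))) \<longlongrightarrow> 1 - l) at_top" by (intro tendsto_intros l)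
  then have "((\<lambda>z. g (- z)) \<longlongrightarrow> 1 - l) at_top" by simp
  then have "(g \<longlongrightarrow> 1 - l) at_bot" by (simp add: at_bot_mirror filterlim_filtermap)
  moreover have "1 - l \<le> g z" for z using l(2)[of "- z"] by simp
  ultimately show ?thesis using that[of "1 - l"] l by auto
qed

lemma mono_tendsto_at_top_le:
  fixes g :: "real \<Rightarrow> real"
  assumes "mono g" "(g \<longlongrightarrow> l) at_top" shows "g z \<le> l"
proof (rule tendsto_lowerbound[OF assms(2)])
  show "\<forall>\<^sub>F x in at_top. g z \<le> g x"
    using eventually_ge_at_top[of z] by eventually_elim (rule monoD[OF assms(1)])
qed simp

lemma mono_tendsto_at_bot_ge:
  fixes g :: "real \<Rightarrow> real"
  assumes "mono g" "(g \<longlongrightarrow> l) at_bot" shows "l \<le> g z"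
proof (rule tendsto_upperbound[OF assms(2)])
  show "\<forall>\<^sub>F x in at_bot. g x \<le> g z"
    using eventually_le_at_bot[of z] by eventually_elim (rule monoD[OF assms(1)])
qed simp

lemma mono_limits_profile:
  assumes "mono g" "(g \<longlongrightarrow> 0) at_bot" "(g \<longlongrightarrow> 1) at_top" shows "profile g"
  using mono_tendsto_at_top_le[OF assms(1,3)] mono_tendsto_at_bot_ge[OF assms(1,2)] assms(1)
  by (auto intro: profileI)

text \<open>Monotonicity turns convergence off a countable set into convergence along moving points:
  \<open>g n (y n)\<close> is squeezed by the values of \<open>g n\<close> at fixed good points just
  left and just right of \<open>y'\<close>, where \<open>h\<close> is close to
  \<open>h y'\<close>.\<close>

lemma profile_seq_tendsto:
  assumes g: "\<And>n. profile (g n)" "profile h"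
    and X: "countable X" "\<And>z. z \<notin> X \<Longrightarrow> (\<lambda>n. g n z) \<longlonglongrightarrow> h z"
    and y: "y \<longlonglongrightarrow> y'" "isCont h y'"
  shows "(\<lambda>n. g n (y n)) \<longlonglongrightarrow> h y'"
proof (rule order_tendstoI)
  fix a assume "a < h y'"
  from y(2) this have "\<forall>\<^sub>F x in at y'. a < h x" by (simp add: isCont_def order_tendstoD)
  then obtain d where d: "d > 0" "\<And>x. x \<noteq> y' \<Longrightarrow> dist x y' < d \<Longrightarrow> a < h x" by (auto simp: eventually_at)
  obtain w where w: "y' - d < w" "w < y'" "w \<notin> X" by (rule countable_dense[OF X(1), of "y' - d" y']) (use d in auto)
  have "a < h w" using d(2)[of w] w by (auto simp: dist_real_def)
  then have "\<forall>\<^sub>F n in sequentially. a < g n w" using X(2)[OF w(3)] by (auto dest: order_tendstoD)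
  moreover have "\<forall>\<^sub>F n in sequentially. w < y n" using y(1) w(2) by (auto dest: order_tendstoD)
  ultimately show "\<forall>\<^sub>F n in sequentially. a < g n (y n)"
    by eventually_elim (use profileD(2)[OF g(1)] in \<open>blast intro: less_le_trans less_imp_le\<close>)
next
  fix a assume "h y' < a"
  from y(2) this have "\<forall>\<^sub>F x in at y'. h x < a" by (simp add: isCont_def order_tendstoD)
  then obtain d where d: "d > 0" "\<And>x. x \<noteq> y' \<Longrightarrow> dist x y' < d \<Longrightarrow> h x < a" by (auto simp: eventually_at)
  obtain w where w: "y' < w" "w < y' + d" "w \<notin> X" by (rule countable_dense[OF X(1), of y' "y' + d"]) (use d in auto)
  have "h w < a" using d(2)[of w] w by (auto simp: dist_real_def)
  then have "\<forall>\<^sub>F n in sequentially. g n w < a" using X(2)[OF w(3)] by (auto dest: order_tendstoD)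
  moreover have "\<forall>\<^sub>F n in sequentially. y n < w" using y(1) w(1) by (auto dest: order_tendstoD)
  ultimately show "\<forall>\<^sub>F n in sequentially. g n (y n) < a"
    by eventually_elim (use profileD(2)[OF g(1)] in \<open>blast intro: le_less_trans less_imp_le\<close>)
qed

section \<open>Right-continuous representatives\<close>

text \<open>Right continuity picks one representative among monotone functions that agree off a
  countable set; it is also the normalisation produced by Helly's selection theorem.\<close>

definition rcont :: "(real \<Rightarrow> real) \<Rightarrow> bool" where
  "rcont g \<longleftrightarrow> (\<forall>x. continuous (at_right x) g)"

lemma rcont_seqD:
  assumes "rcont g" "y \<longlonglongrightarrow> x" "\<And>n. x \<le> y n"
  shows "(\<lambda>n. g (y n)) \<longlonglongrightarrow> g x"
proof -
  have "continuous (at x within {x..}) g"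
    using assms(1) by (simp add: rcont_def continuous_within at_within_Ici_at_right)
  then show ?thesis using assms(2,3) by (auto simp: continuous_within_sequentially o_def)
qed

lemma rcont_seqI:
  assumes "\<And>x y. y \<longlonglongrightarrow> x \<Longrightarrow> (\<And>n. x < y n) \<Longrightarrow> (\<lambda>n. g (y n)) \<longlonglongrightarrow> g x"
  shows "rcont g"
  unfolding rcont_def continuous_within_sequentially using assms by (auto simp: o_def)

text \<open>The complement of a countable set accumulates at \<open>x\<close> from the right, so
  both values are limits along one common sequence.\<close>

lemma rcont_eqI:
  assumes "rcont g" "rcont h" "countable X" "x < b"
    and eq: "\<And>z. x < z \<Longrightarrow> z < b \<Longrightarrow> z \<notin> X \<Longrightarrow> g z = h z"
  shows "g x = h x"
proof -
  define d where "d n = (b - x) / (real n + 1)" for n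
  have d: "d n > 0" "d n \<le> b - x" for n
    using assms(4) divide_left_mono[of 1 "real n + 1" "b - x"] by (auto simp: d_def)
  have "\<exists>y. x < y \<and> y < x + d n \<and> y \<notin> X" for n
    by (rule countable_dense[OF assms(3), of x "x + d n"]) (use d[of n] in auto)
  then obtain y where y: "\<And>n. x < y n" "\<And>n. y n < x + d n" "\<And>n. y n \<notin> X" by metis
  have "d \<longlonglongrightarrow> 0" unfolding d_def by real_asymp
  then have up: "(\<lambda>n. x + d n) \<longlonglongrightarrow> x" using tendsto_add[OF tendsto_const, of d 0 sequentially x] by simp
  have ylim: "y \<longlonglongrightarrow> x"
    by (rule tendsto_sandwich[OF _ _ tendsto_const up]) (use y in \<open>auto intro!: always_eventually less_imp_le\<close>)
  have "(\<lambda>n. g (y n)) \<longlonglongrightarrow> g x" "(\<lambda>n. h (y n)) \<longlonglongrightarrow> h x"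
    using rcont_seqD[OF assms(1) ylim less_imp_le] rcont_seqD[OF assms(2) ylim less_imp_le] y(1)
    by blast+
  moreover have "g (y n) = h (y n)" for n
    using eq[of "y n"] y(1,2,3)[of n] d(2)[of n] by simp
  ultimately show ?thesis using LIMSEQ_unique by auto
qed

lemma continuous_imp_rcont: "(\<And>x. isCont g x) \<Longrightarrow> rcont g"
  by (auto simp: rcont_def intro: continuous_at_imp_continuous_at_within)

section \<open>Averages against the exponential law\<close>

locale exponential_average =
  fixes \<alpha> :: real
  assumes alpha_pos: "0 < \<alpha>"
begin

abbreviation E :: "real measure" where
  "E \<equiv> density lborel (exponential_density \<alpha>)"

text \<open>For \<open>c \<noteq> 0\<close> and continuous profiles \<open>g\<close>, this is the
  bounded solution \<open>h\<close> of \<open>c * h' = \<alpha> * (g - h)\<close>, written as an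
  integral. Unlike the differential equation, the formula stays meaningful for \<open>c = 0\<close>
  and for discontinuous \<open>g\<close>.\<close>

definition S :: "real \<Rightarrow> (real \<Rightarrow> real) \<Rightarrow> real \<Rightarrow> real" where
  "S c g z = (\<integral>s. g (z - c * s) \<partial>E)"

lemma prob_E: "prob_space E"
  using alpha_pos by (rule prob_space_exponential_density)

sublocale E: prob_space E by (rule prob_E)

lemma AE_E_pos: "AE s in E. 0 < s"
proof -
  have "AE s in lborel. s \<noteq> (0::real)" by (rule AE_lborel_singleton)
  then show ?thesis by (subst AE_density) (auto simp: exponential_density_def)
qed

lemma AE_E_countable:
  assumes "countable X" shows "AE s in E. s \<notin> X"
proof -
  have "AE s in lborel. s \<notin> X"
    by (rule AE_not_in) (use assms countable_imp_null_set_lborel in auto)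
  then show ?thesis by (subst AE_density) auto
qed

text \<open>For nonzero speed the sampled points have a diffuse law, so an average never sees a
  countable set; this is the source of smoothing.\<close>

lemma AE_E_countable_affine:
  assumes "countable X" "c \<noteq> 0" shows "AE s in E. z - c * s \<notin> X"
proof -
  have "countable ((\<lambda>x. (z - x) / c) ` X)" using assms by simp
  from AE_E_countable[OF this] show ?thesis
  proof eventually_elim
    case (elim s)
    show ?case
    proof
      assume "z - c * s \<in> X"
      then have "(z - (z - c * s)) / c \<in> (\<lambda>x. (z - x) / c) ` X" by blast
      then show False using elim assms by simp
    qed
  qed
qed

lemma integrable_E_profile [simp]: "profile g \<Longrightarrow> integrable E (\<lambda>s. g (z - c * s))"
proof (rule E.integrable_const_bound[where B = 1])
  assume g: "profile g"
  show "AE s in E. norm (g (z - c * s)) \<le> 1" using profileD(3,4)[OF g] by auto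
  show "(\<lambda>s. g (z - c * s)) \<in> borel_measurable E"
    using profile_measurable[OF g] by simp
qed

lemma E_tendsto:
  fixes h :: "nat \<Rightarrow> real \<Rightarrow> real"
  assumes "\<And>n. h n \<in> borel_measurable borel" "k \<in> borel_measurable borel"
    and "\<And>n s. \<bar>h n s\<bar> \<le> 1" "AE s in E. (\<lambda>n. h n s) \<longlonglongrightarrow> k s"
  shows "(\<lambda>n. \<integral>s. h n s \<partial>E) \<longlonglongrightarrow> (\<integral>s. k s \<partial>E)"
proof (rule integral_dominated_convergence[where w = "\<lambda>_. 1 :: real"])
  show "AE s in E. norm (h n s) \<le> 1" for n using assms(3) by simp
qed (use assms in auto)

lemma S_tendsto:
  assumes "\<And>n. profile (g n)" "profile h"
    and "AE s in E. (\<lambda>n. g n (z n - c n * s)) \<longlonglongrightarrow> h (z' - c' * s)"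
  shows "(\<lambda>n. S (c n) (g n) (z n)) \<longlonglongrightarrow> S c' h z'"
  unfolding S_def
proof (rule E_tendsto[OF _ _ _ assms(3)])
  show "(\<lambda>s. g n (z n - c n * s)) \<in> borel_measurable borel" for n
    using profile_measurable[OF assms(1)[of n]] by simp
  show "(\<lambda>s. h (z' - c' * s)) \<in> borel_measurable borel"
    using profile_measurable[OF assms(2)] by simp
  show "\<bar>g n (z n - c n * s)\<bar> \<le> 1" for n s using profileD(3,4)[OF assms(1)[of n]] by simp
qed

lemma S_const [simp]: "S c (\<lambda>_. k) z = k"
  by (simp add: S_def E.prob_space[simplified])

lemma S_zero [simp]: "S 0 g z = g z"
  by (simp add: S_def E.prob_space[simplified])

lemma S_mono:
  assumes "profile g" "profile h" "\<And>y. g y \<le> h y"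
  shows "S c g z \<le> S c h z"
  unfolding S_def by (intro integral_mono integrable_E_profile assms)

lemma S_mono_countable:
  assumes "profile g" "profile h" "countable X" "\<And>y. y \<notin> X \<Longrightarrow> g y \<le> h y" "c \<noteq> 0"
  shows "S c g z \<le> S c h z"
  unfolding S_def using AE_E_countable_affine[OF assms(3,5), of z] assms
  by (intro integral_mono_AE integrable_E_profile) auto

lemma S_le_shift:
  assumes "profile g" "profile h" "\<And>y. g y \<le> h y + m"
  shows "S c g z \<le> S c h z + m"
proof -
  have "S c g z \<le> (\<integral>s. h (z - c * s) + m \<partial>E)"
    unfolding S_def
    by (intro integral_mono Bochner_Integration.integrable_add integrable_E_profile assms
        finite_measure.integrable_const E.finite_measure_axioms)
  also have "\<dots> = S c h z + m"
    using assms by (simp add: S_def E.prob_space[simplified])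
  finally show ?thesis .
qed

lemma S_profile: "profile g \<Longrightarrow> profile (S c g)"
proof (rule profileI)
  assume g: "profile g"
  show "mono (S c g)" unfolding S_def mono_def
    by (auto intro!: integral_mono integrable_E_profile g profileD(2)[OF g])
  show "0 \<le> S c g z" for z using profileD(3)[OF g] by (simp add: S_def)
  show "S c g z \<le> 1" for z
    using S_mono[OF g, of "\<lambda>_. 1" c z] profileD(4)[OF g] by (auto simp: profile_def mono_def)
qed

text \<open>Since \<open>s > 0\<close> almost surely, a larger speed samples the non-decreasing
  function further to the left.\<close>

lemma S_antimono_speed:
  assumes "profile g" "c \<le> d" shows "S d g z \<le> S c g z"
  unfolding S_def
proof (intro integral_mono_AE integrable_E_profile assms)
  show "AE s in E. g (z - d * s) \<le> g (z - c * s)"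
    using AE_E_pos
  proof eventually_elim
    case (elim s)
    have "z - d * s \<le> z - c * s" using elim assms(2) mult_right_mono[of c d s] by simp
    then show ?case by (rule profileD(2)[OF assms(1)])
  qed
qed

lemma S_shift: "S c (\<lambda>y. g (y + s)) z = S c g (z + s)"
  by (simp add: S_def algebra_simps)

lemma S_continuous: assumes "profile g" "c \<noteq> 0" shows "isCont (S c g) z"
proof (subst continuous_at_sequentially, intro allI impI)
  fix y :: "nat \<Rightarrow> real" assume y: "y \<longlonglongrightarrow> z"
  have "(\<lambda>n. S c g (y n)) \<longlonglongrightarrow> S c g z"
  proof (rule S_tendsto[OF assms(1) assms(1)])
    show "AE s in E. (\<lambda>n. g (y n - c * s)) \<longlonglongrightarrow> g (z - c * s)"
      using AE_E_countable_affine[OF profile_discont[OF assms(1)] assms(2), of z]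
    proof eventually_elim
      case (elim s)
      then have "isCont g (z - c * s)" by simp
      moreover have "(\<lambda>n. y n - c * s) \<longlonglongrightarrow> z - c * s" by (intro tendsto_intros y)
      ultimately show ?case by (rule isCont_tendsto_compose)
    qed
  qed
  then show "(S c g \<circ> y) \<longlonglongrightarrow> S c g z" by (simp add: o_def)
qed

lemma S_rcont: assumes "profile g" "rcont g" shows "rcont (S c g)"
proof (rule rcont_seqI)
  fix x :: real and y :: "nat \<Rightarrow> real" assume y: "y \<longlonglongrightarrow> x" "\<And>n. x < y n"
  show "(\<lambda>n. S c g (y n)) \<longlonglongrightarrow> S c g x"
  proof (rule S_tendsto[OF assms(1) assms(1)], rule AE_I2)
    fix s
    show "(\<lambda>n. g (y n - c * s)) \<longlonglongrightarrow> g (x - c * s)"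
      proof (rule rcont_seqD[OF assms(2)])
      show "(\<lambda>n. y n - c * s) \<longlonglongrightarrow> x - c * s" by (intro tendsto_intros y)
      show "x - c * s \<le> y n - c * s" for n using y(2)[of n] by simp
    qed
  qed
qed

text \<open>If \<open>c' \<noteq> 0\<close>, the sampled points almost surely avoid the
  discontinuities of \<open>h\<close>. If \<open>c' = 0\<close>, they all collapse to
  \<open>z\<close>, so \<open>z\<close> itself must be a continuity point; hence the exceptional
  set.\<close>

lemma S_tendsto_countable:
  assumes g: "\<And>n. profile (g n)" "profile h"
    and X: "countable X" "\<And>z. z \<notin> X \<Longrightarrow> (\<lambda>n. g n z) \<longlonglongrightarrow> h z" and c: "c \<longlonglongrightarrow> c'"
  obtains Y where "countable Y" "\<And>z. z \<notin> Y \<Longrightarrow> (\<lambda>n. S (c n) (g n) z) \<longlonglongrightarrow> S c' h z"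
proof
  show "countable {z. \<not> isCont h z}" by (rule profile_discont[OF g(2)])
  fix z assume z: "z \<notin> {z. \<not> isCont h z}"
  show "(\<lambda>n. S (c n) (g n) z) \<longlonglongrightarrow> S c' h z"
  proof (rule S_tendsto[OF g])
    have "AE s in E. isCont h (z - c' * s)"
    proof (cases "c' = 0")
      case True then show ?thesis using z by simp
    next
      case False
      show ?thesis using AE_E_countable_affine[OF profile_discont[OF g(2)] False, of z] by simp
    qed
    then show "AE s in E. (\<lambda>n. g n (z - c n * s)) \<longlonglongrightarrow> h (z - c' * s)"
    proof eventually_elim
      case (elim s)
      have "(\<lambda>n. z - c n * s) \<longlonglongrightarrow> z - c' * s" by (intro tendsto_intros c)
      from profile_seq_tendsto[OF g X this elim] show ?case .
    qed
  qed
qed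

lemma S_tendsto_pointwise:
  assumes "\<And>n. profile (g n)" "profile h" "\<And>z. (\<lambda>n. g n z) \<longlonglongrightarrow> h z"
  shows "(\<lambda>n. S c (g n) z) \<longlonglongrightarrow> S c h z"
  by (rule S_tendsto) (use assms in auto)

lemma S_at_top:
  assumes "profile g" "(g \<longlongrightarrow> l) at_top" shows "(S c g \<longlongrightarrow> l) at_top"
proof (rule tendsto_at_topI_sequentially)
  fix y :: "nat \<Rightarrow> real" assume y: "filterlim y at_top sequentially"
  have "(\<lambda>n. \<integral>s. g (y n - c * s) \<partial>E) \<longlonglongrightarrow> (\<integral>s. l \<partial>E)"
  proof (rule E_tendsto)
    show "(\<lambda>s. g (y n - c * s)) \<in> borel_measurable borel" for n
      using profile_measurable[OF assms(1)] by simp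
    show "\<bar>g (y n - c * s)\<bar> \<le> 1" for n s using profileD(3,4)[OF assms(1)] by simp
    have "(\<lambda>n. g (y n - c * s)) \<longlonglongrightarrow> l" for s
      by (rule filterlim_compose[OF assms(2)])
        (use filterlim_tendsto_add_at_top[OF tendsto_const[of "- c * s"] y] in \<open>simp add: add.commute\<close>)
    then show "AE s in E. (\<lambda>n. g (y n - c * s)) \<longlonglongrightarrow> l" by simp
  qed simp
  then show "(\<lambda>n. S c g (y n)) \<longlonglongrightarrow> l" by (simp add: S_def E.prob_space[simplified])
qed

lemma S_at_bot:
  assumes "profile g" "(g \<longlongrightarrow> l) at_bot" shows "(S c g \<longlongrightarrow> l) at_bot"
proof (rule tendsto_at_botI_sequentially)
  fix y :: "nat \<Rightarrow> real" assume y: "filterlim y at_bot sequentially"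
  have "(\<lambda>n. \<integral>s. g (y n - c * s) \<partial>E) \<longlonglongrightarrow> (\<integral>s. l \<partial>E)"
  proof (rule E_tendsto)
    show "(\<lambda>s. g (y n - c * s)) \<in> borel_measurable borel" for n
      using profile_measurable[OF assms(1)] by simp
    show "\<bar>g (y n - c * s)\<bar> \<le> 1" for n s using profileD(3,4)[OF assms(1)] by simp
    have "(\<lambda>n. g (y n - c * s)) \<longlonglongrightarrow> l" for s
      by (rule filterlim_compose[OF assms(2)])
        (use filterlim_tendsto_add_at_bot_iff[OF tendsto_const[of "- c * s"], of y] y in \<open>simp add: add.commute\<close>)
    then show "AE s in E. (\<lambda>n. g (y n - c * s)) \<longlonglongrightarrow> l" by simp
  qed simp
  then show "(\<lambda>n. S c g (y n)) \<longlonglongrightarrow> l" by (simp add: S_def E.prob_space[simplified])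
qed

text \<open>Equality case of integral monotonicity: the difference of the integrands is nonnegative
  and continuous with zero mean, hence vanishes on the whole half line. Equal speeds serve the
  strong maximum principle, distinct speeds the comparison of two speeds.\<close>

lemma S_eq_imp_eq:
  assumes gh: "profile g" "profile h" "\<And>y. isCont g y" "\<And>y. isCont h y"
    and le: "\<And>s. 0 \<le> s \<Longrightarrow> g (z - c * s) \<le> h (w - d * s)" and eq: "S d h w \<le> S c g z" and t: "0 \<le> t"
  shows "g (z - c * t) = h (w - d * t)"
proof (rule ccontr)
  assume neq: "g (z - c * t) \<noteq> h (w - d * t)"
  define k where "k s = h (w - d * s) - g (z - c * s)" for s
  have k_cont: "isCont k s" for s unfolding k_def
    by (intro continuous_intros isCont_o2[where f = "\<lambda>s. w - d * s"] isCont_o2[where f = "\<lambda>s. z - c * s"] gh)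
  have kI: "integrable E k" unfolding k_def
    by (intro Bochner_Integration.integrable_diff integrable_E_profile gh)
  have k0: "AE s in E. 0 \<le> k s" using AE_E_pos by eventually_elim (use le in \<open>auto simp: k_def\<close>)
  have "(\<integral>s. k s \<partial>E) = S d h w - S c g z" unfolding S_def k_def
    by (rule Bochner_Integration.integral_diff) (use gh in auto)
  then have "(\<integral>s. k s \<partial>E) \<le> 0" using eq by simp
  then have "(\<integral>s. k s \<partial>E) = 0" using integral_nonneg_AE[OF k0] by simp
  then have "AE s in E. k s = 0" using integral_nonneg_eq_0_iff_AE[OF kI k0] by simp
  then have ae: "AE s in lborel. 0 < s \<longrightarrow> k s = 0"
    using alpha_pos by (subst (asm) AE_density) (auto simp: exponential_density_def elim!: eventually_mono)
  have "isCont k t" by (rule k_cont)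
  moreover have "k t \<noteq> 0" using neq by (simp add: k_def)
  ultimately have "\<forall>\<^sub>F s in at t. k s \<noteq> 0"
    unfolding isCont_def by (rule tendsto_imp_eventually_ne)
  then obtain e where e: "e > 0" "\<And>s. s \<noteq> t \<Longrightarrow> dist s t < e \<Longrightarrow> k s \<noteq> 0" by (auto simp: eventually_at)
  \<comment> \<open>The interval lies to the right of \<open>t\<close>, so it stays inside the
    support of the density even when \<open>t = 0\<close>.\<close>
  have "AE s in lborel. s \<notin> {t<..<t+e}"
    using ae by eventually_elim (use e t in \<open>auto simp: dist_real_def\<close>)
  then have "emeasure lborel {t<..<t+e} = 0"
    by (subst (asm) AE_iff_measurable[of "{t<..<t+e}"]) auto
  then show False using e by simp
qed

end

subsection \<open>The order-preserving operator\<close>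

text \<open>The lower bound is monotonicity of \<open>h\<close>; the upper bound comes from a single
  \<open>g m\<close> that is already close to \<open>h\<close> at \<open>x\<close>. This is why
  solutions are constructed by iterating downwards.\<close>

lemma rcont_INF:
  assumes "\<And>n. profile (g n)" "\<And>n. rcont (g n)" "decseq g" "profile h" "\<And>z. (\<lambda>n. g n z) \<longlonglongrightarrow> h z"
  shows "rcont h"
proof (rule rcont_seqI)
  fix x :: real and y :: "nat \<Rightarrow> real" assume y: "y \<longlonglongrightarrow> x" "\<And>n. x < y n"
  have le: "h z \<le> g n z" for n z
    by (rule decseq_ge[OF _ assms(5)]) (use assms(3) in \<open>simp add: monotone_def le_fun_def\<close>)
  show "(\<lambda>n. h (y n)) \<longlonglongrightarrow> h x"
  proof (rule order_tendstoI)
    fix a assume "a < h x"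
    moreover have "h x \<le> h (y n)" for n using y(2)[of n] by (intro profileD(2)[OF assms(4)]) simp
    ultimately show "\<forall>\<^sub>F n in sequentially. a < h (y n)"
      by (intro always_eventually allI) (rule less_le_trans)
  next
    fix a assume "h x < a"
    then have "\<forall>\<^sub>F n in sequentially. g n x < a" using assms(5)[of x] by (auto dest: order_tendstoD)
    then obtain m where m: "g m x < a" by (auto simp: eventually_sequentially)
    have "(\<lambda>n. g m (y n)) \<longlonglongrightarrow> g m x"
      by (rule rcont_seqD[OF assms(2) y(1) less_imp_le[OF y(2)]])
    from order_tendstoD(2)[OF this m] show "\<forall>\<^sub>F n in sequentially. h (y n) < a"
      by eventually_elim (rule le_less_trans[OF le])
  qed
qed

text \<open>Convexity makes the increments along \<open>z + \<nat>\<close> non-decreasing, so one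
  positive increment would force linear growth beyond the bound 1.\<close>

lemma mono_discrete_convex_periodic:
  fixes F :: "real \<Rightarrow> real"
  assumes "mono F" "\<And>z. F z \<le> 1" "\<And>z. 0 \<le> F (z + 1) + F (z - 1) - 2 * F z"
  shows "F (z + 1) = F z"
proof (rule antisym)
  show "F z \<le> F (z + 1)" using assms(1) by (simp add: mono_def)
  show "F (z + 1) \<le> F z"
  proof (rule ccontr)
    assume neg: "\<not> F (z + 1) \<le> F z"
    define e where "e = F (z + 1) - F z"
    have e: "e > 0" using neg by (simp add: e_def)
    have step: "e \<le> F (z + real n + 1) - F (z + real n)" for n
    proof (induction n)
      case 0 show ?case by (simp add: e_def)
    next
      case (Suc n)
      have "0 \<le> F (z + real n + 1 + 1) + F (z + real n + 1 - 1) - 2 * F (z + real n + 1)" by (rule assms(3))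
      then show ?case using Suc by (simp add: algebra_simps)
    qed
    have "F z + real n * e \<le> F (z + real n)" for n
    proof (induction n)
      case (Suc n)
      then show ?case using step[of n] by (simp add: algebra_simps)
    qed simp
    then have *: "real n * e \<le> 1 - F z" for n
      using order_trans[OF _ assms(2)[of "z + real n"]] by (simp add: algebra_simps)
    obtain n :: nat where "(1 - F z) / e < real n" using reals_Archimedean2 by blast
    then have "1 - F z < real n * e" using e by (simp add: divide_less_eq)
    with *[of n] show False by simp
  qed
qed

lemma periodic_limits_eq:
  fixes F :: "real \<Rightarrow> real"
  assumes "\<And>z. F (z + 1) = F z" "(F \<longlongrightarrow> a) at_bot" "(F \<longlongrightarrow> b) at_top"
  shows "a = b"
proof -
  have F: "F (z + real n) = F z" for z :: real and n
  proof (induction n)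
    case (Suc n) then show ?case using assms(1)[of "z + real n"] by (simp add: algebra_simps)
  qed simp
  have F: "F (real n) = F 0" "F (- real n) = F 0" for n
    using F[of 0 n] F[of "- real n" n] by auto
  have "(\<lambda>n. F (real n)) \<longlonglongrightarrow> b" by (rule filterlim_compose[OF assms(3) filterlim_real_sequentially])
  moreover have "(\<lambda>n. F (- real n)) \<longlonglongrightarrow> a"
    by (rule filterlim_compose[OF assms(2)]) (simp add: filterlim_uminus_at_bot filterlim_real_sequentially)
  ultimately have "b = F 0" "a = F 0" unfolding F using LIMSEQ_unique tendsto_const by blast+
  then show ?thesis by simp
qed

section \<open>Bistable nonlinearities and the operators \<open>N\<close> and
  \<open>T\<close>\<close>

locale bistable_chain = exponential_average +
  fixes f :: "real \<Rightarrow> real" and \<theta> B \<delta> \<mu> :: real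
  assumes B_nonneg: "0 \<le> B" and alpha_large: "4 + 2 * B < \<alpha>"
    and f_lipschitz: "\<bar>f x - f y\<bar> \<le> B * \<bar>x - y\<bar>"
    and f_0 [simp]: "f 0 = 0" and f_1 [simp]: "f 1 = 0" and f_theta [simp]: "f \<theta> = 0"
    and theta: "0 < \<theta>" "\<theta> < 1"
    and f_neg: "0 < x \<Longrightarrow> x < \<theta> \<Longrightarrow> f x < 0"
    and f_pos: "\<theta> < x \<Longrightarrow> x < 1 \<Longrightarrow> 0 < f x"
    and delta_pos: "0 < \<delta>" and mu_pos: "0 < \<mu>"
    and f_stable_0: "0 \<le> x \<Longrightarrow> x \<le> y \<Longrightarrow> y \<le> \<delta> \<Longrightarrow> f y - f x \<le> - \<mu> * (y - x)"
    and f_stable_1: "1 - \<delta> \<le> x \<Longrightarrow> x \<le> y \<Longrightarrow> y \<le> 1 \<Longrightarrow> f y - f x \<le> - \<mu> * (y - x)"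
begin

lemma f_isCont: "isCont f x"
proof -
  have "B-lipschitz_on UNIV f"
    using f_lipschitz B_nonneg by (auto simp: lipschitz_on_def dist_real_def)
  then show ?thesis
    by (metis UNIV_I continuous_on_eq_continuous_at lipschitz_on_continuous_on open_UNIV)
qed

lemma f_zeros: "f x = 0 \<Longrightarrow> 0 \<le> x \<Longrightarrow> x \<le> 1 \<Longrightarrow> x = 0 \<or> x = \<theta> \<or> x = 1"
  using f_neg[of x] f_pos[of x] by (cases x \<theta> rule: linorder_cases) fastforce+

text \<open>Chosen so that the second wave equation reads \<open>c * \<phi>\<^sub>2' = \<alpha> * (N
  \<phi>\<^sub>1 - \<phi>\<^sub>2)\<close>.\<close>

definition N :: "(real \<Rightarrow> real) \<Rightarrow> real \<Rightarrow> real" where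
  "N g z = g z + 2 / \<alpha> * (g (z + 1) + g (z - 1) - 2 * g z + f (g z))"

text \<open>The least weight that \<open>N g z\<close> puts on \<open>g z\<close>, after the worst
  case of the Lipschitz bound for \<open>f\<close>.\<close>

definition \<kappa> :: real where "\<kappa> = 1 - (4 + 2 * B) / \<alpha>"

lemma kappa_pos: "0 < \<kappa>"
  using alpha_large alpha_pos by (simp add: \<kappa>_def)

text \<open>A quantitative form of monotonicity. It keeps the gaps at \<open>z\<close> and at both
  neighbours, which is what the equality case of the strong maximum principle and the contraction
  estimate read off.\<close>

lemma N_diff:
  assumes "g z \<le> h z"
  shows "\<kappa> * (h z - g z) + 2 / \<alpha> * (h (z + 1) - g (z + 1) + (h (z - 1) - g (z - 1))) \<le> N h z - N g z"
proof -
  have "- (B * (h z - g z)) \<le> f (h z) - f (g z)" using f_lipschitz[of "h z" "g z"] assms by (simp add: abs_if split: if_splits)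
  then have "2 / \<alpha> * (- (B * (h z - g z))) \<le> 2 / \<alpha> * (f (h z) - f (g z))"
    using alpha_pos by (intro mult_left_mono) auto
  then show ?thesis by (simp add: N_def \<kappa>_def algebra_simps add_divide_distrib diff_divide_distrib)
qed

lemma N_mono:
  assumes "g z \<le> h z" "g (z + 1) \<le> h (z + 1)" "g (z - 1) \<le> h (z - 1)"
  shows "N g z \<le> N h z"
proof -
  have "0 \<le> \<kappa> * (h z - g z)" using kappa_pos assms by simp
  moreover have "0 \<le> 2 / \<alpha> * (h (z + 1) - g (z + 1) + (h (z - 1) - g (z - 1)))"
    using alpha_pos assms by simp
  ultimately show ?thesis using N_diff[of g z h, OF assms(1)] by linarith
qed

lemma N_const: "N (\<lambda>_. k) z = k + 2 / \<alpha> * f k" by (simp add: N_def)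

lemma N_shift: "N (\<lambda>y. g (y + s)) z = N g (z + s)" by (simp add: N_def algebra_simps)

lemma N_profile: assumes "profile g" shows "profile (N g)"
proof (rule profileI)
  show "mono (N g)"
  proof (rule monoI)
    fix x y :: real assume "x \<le> y"
    \<comment> \<open>Monotonicity of \<open>N g\<close> is order preservation applied to
      \<open>g\<close> and its left translate; the bounds below compare with the fixed constants 0
      and 1.\<close>
    then have "N g x \<le> N (\<lambda>z. g (z + (y - x))) x" by (intro N_mono profileD(2)[OF assms]) auto
    then show "N g x \<le> N g y" by (simp add: N_shift)
  qed
  show "0 \<le> N g z" for z
    using N_mono[of "\<lambda>_. 0" z g] profileD(3)[OF assms] by (simp add: N_const)
  show "N g z \<le> 1" for z
    using N_mono[of g z "\<lambda>_. 1"] profileD(4)[OF assms] by (simp add: N_const)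
qed

lemma N_tendsto:
  assumes "((\<lambda>n. g n (z n)) \<longlongrightarrow> a) F" "((\<lambda>n. g n (z n + 1)) \<longlongrightarrow> b) F" "((\<lambda>n. g n (z n - 1)) \<longlongrightarrow> d) F"
  shows "((\<lambda>n. N (g n) (z n)) \<longlongrightarrow> a + 2 / \<alpha> * (b + d - 2 * a + f a)) F"
  unfolding N_def by (intro tendsto_intros assms isCont_tendsto_compose[OF f_isCont])

lemma N_rcont: assumes "rcont g" shows "rcont (N g)"
proof (rule rcont_seqI)
  fix x :: real and y :: "nat \<Rightarrow> real" assume y: "y \<longlonglongrightarrow> x" "\<And>n. x < y n"
  have "(\<lambda>n. g (y n + t)) \<longlonglongrightarrow> g (x + t)" for t
  proof (rule rcont_seqD[OF assms])
    show "(\<lambda>n. y n + t) \<longlonglongrightarrow> x + t" by (intro tendsto_intros y)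
    show "x + t \<le> y n + t" for n using y(2)[of n] by simp
  qed
  from N_tendsto[of "\<lambda>_. g" y, OF this[of 0, simplified] this[of 1] this[of "-1", simplified]]
  show "(\<lambda>n. N g (y n)) \<longlonglongrightarrow> N g x" by (simp add: N_def)
qed

lemma N_isCont: assumes "\<And>z. isCont g z" shows "isCont (N g) z"
proof -
  have "((\<lambda>y. g (y + t)) \<longlongrightarrow> g (z + t)) (at z)" for t
    by (rule isCont_tendsto_compose[OF assms]) (intro tendsto_intros)
  from N_tendsto[of "\<lambda>_. g" "\<lambda>y. y", OF this[of 0, simplified] this[of 1] this[of "-1", simplified]]
  show ?thesis by (simp add: isCont_def N_def[abs_def])
qed

lemma N_tendsto_countable:
  assumes X: "countable X" "\<And>z. z \<notin> X \<Longrightarrow> (\<lambda>n. g n z) \<longlonglongrightarrow> h z"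
  obtains Y where "countable Y" "\<And>z. z \<notin> Y \<Longrightarrow> (\<lambda>n. N (g n) z) \<longlonglongrightarrow> N h z"
proof
  show "countable (X \<union> (\<lambda>x. x - 1) ` X \<union> (\<lambda>x. x + 1) ` X)" using X(1) by simp
  fix z assume z: "z \<notin> X \<union> (\<lambda>x. x - 1) ` X \<union> (\<lambda>x. x + 1) ` X"
  have "z + 1 \<notin> X" using z by (metis UnCI add_diff_cancel_right' image_eqI)
  moreover have "z - 1 \<notin> X" using z by (metis UnCI diff_add_cancel image_eqI)
  ultimately show "(\<lambda>n. N (g n) z) \<longlonglongrightarrow> N h z"
    using N_tendsto[of g "\<lambda>_. z", OF X(2) X(2) X(2)] z by (simp add: N_def)
qed

lemma N_tendsto_pointwise:
  assumes "\<And>z. (\<lambda>n. g n z) \<longlonglongrightarrow> h z" shows "(\<lambda>n. N (g n) z) \<longlonglongrightarrow> N h z"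
  using N_tendsto[of g "\<lambda>_. z", OF assms assms assms] by (simp add: N_def)

lemma N_at_top: assumes "(g \<longlongrightarrow> l) at_top" shows "(N g \<longlongrightarrow> l + 2 / \<alpha> * f l) at_top"
proof -
  have lim: "((\<lambda>y. g (t + y)) \<longlongrightarrow> l) at_top" for t
    by (rule filterlim_compose[OF assms filterlim_tendsto_add_at_top[OF tendsto_const filterlim_ident]])
  have "((\<lambda>y. g (y + t)) \<longlongrightarrow> l) at_top" for t using lim[of t] by (simp add: add.commute)
  from N_tendsto[of "\<lambda>_. g" "\<lambda>y. y", OF this[of 0, simplified] this[of 1] this[of "-1", simplified]]
  show ?thesis by simp
qed

lemma N_at_bot: assumes "(g \<longlongrightarrow> l) at_bot" shows "(N g \<longlongrightarrow> l + 2 / \<alpha> * f l) at_bot"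
proof -
  have lim: "((\<lambda>y. g (t + y)) \<longlongrightarrow> l) at_bot" for t
    by (rule filterlim_compose[OF assms])
      (simp only: filterlim_tendsto_add_at_bot_iff[OF tendsto_const] filterlim_ident)
  have "((\<lambda>y. g (y + t)) \<longlongrightarrow> l) at_bot" for t using lim[of t] by (simp add: add.commute)
  from N_tendsto[of "\<lambda>_. g" "\<lambda>y. y", OF this[of 0, simplified] this[of 1] this[of "-1", simplified]]
  show ?thesis by simp
qed

definition T :: "real \<Rightarrow> (real \<Rightarrow> real) \<Rightarrow> real \<Rightarrow> real" where
  "T c g = S c (S c (N g))"

lemma T_zero: "T 0 g = N g" by (simp add: T_def fun_eq_iff)

lemma T_profile: "profile g \<Longrightarrow> profile (T c g)"
  by (simp add: T_def S_profile N_profile)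

lemma T_mono:
  assumes "profile g" "profile h" "\<And>y. g y \<le> h y" shows "T c g z \<le> T c h z"
  unfolding T_def by (intro S_mono S_profile N_profile N_mono assms)

lemma T_shift: "T c (\<lambda>y. g (y + s)) z = T c g (z + s)"
proof -
  have "N (\<lambda>y. g (y + s)) = (\<lambda>z. N g (z + s))" by (simp add: fun_eq_iff N_shift)
  moreover have "S c (\<lambda>z. N g (z + s)) = (\<lambda>z. S c (N g) (z + s))" by (simp add: fun_eq_iff S_shift)
  ultimately show ?thesis by (simp add: T_def S_shift)
qed

lemma T_antimono_speed:
  assumes "profile g" "c \<le> d" shows "T d g z \<le> T c g z"
proof -
  have "T d g z \<le> S c (S d (N g)) z"
    unfolding T_def by (intro S_antimono_speed S_profile N_profile assms)
  also have "\<dots> \<le> T c g z"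
    unfolding T_def by (intro S_antimono_speed S_mono S_profile N_profile assms)
  finally show ?thesis .
qed

lemma T_isCont: "profile g \<Longrightarrow> c \<noteq> 0 \<Longrightarrow> isCont (T c g) z"
  by (simp add: T_def S_continuous S_profile N_profile)

lemma T_rcont: "profile g \<Longrightarrow> rcont g \<Longrightarrow> rcont (T c g)"
  by (simp add: T_def S_rcont S_profile N_profile N_rcont)

lemma T_tendsto_pointwise:
  assumes "\<And>n. profile (g n)" "profile h" "\<And>z. (\<lambda>n. g n z) \<longlonglongrightarrow> h z"
  shows "(\<lambda>n. T c (g n) z) \<longlonglongrightarrow> T c h z"
  unfolding T_def by (intro S_tendsto_pointwise N_tendsto_pointwise S_profile N_profile assms)

lemma T_tendsto_countable:
  assumes g: "\<And>n. profile (g n)" "profile h"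
    and X: "countable X" "\<And>z. z \<notin> X \<Longrightarrow> (\<lambda>n. g n z) \<longlonglongrightarrow> h z" and c: "c \<longlonglongrightarrow> c'"
  obtains Y where "countable Y" "\<And>z. z \<notin> Y \<Longrightarrow> (\<lambda>n. T (c n) (g n) z) \<longlonglongrightarrow> T c' h z"
proof -
  obtain Y1 where 1: "countable Y1" "\<And>z. z \<notin> Y1 \<Longrightarrow> (\<lambda>n. N (g n) z) \<longlonglongrightarrow> N h z"
    by (rule N_tendsto_countable[OF X]) auto
  obtain Y2 where 2: "countable Y2" "\<And>z. z \<notin> Y2 \<Longrightarrow> (\<lambda>n. S (c n) (N (g n)) z) \<longlonglongrightarrow> S c' (N h) z"
    by (rule S_tendsto_countable[OF N_profile[OF g(1)] N_profile[OF g(2)] 1 c]) auto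
  show ?thesis unfolding T_def
    by (rule S_tendsto_countable[OF S_profile[OF N_profile[OF g(1)]] S_profile[OF N_profile[OF g(2)]] 2 c])
      (use that[unfolded T_def] in auto)
qed

lemma T_at_top: "profile g \<Longrightarrow> (g \<longlongrightarrow> l) at_top \<Longrightarrow> (T c g \<longlongrightarrow> l + 2 / \<alpha> * f l) at_top"
  unfolding T_def by (intro S_at_top N_at_top S_profile N_profile)

lemma T_at_bot: "profile g \<Longrightarrow> (g \<longlongrightarrow> l) at_bot \<Longrightarrow> (T c g \<longlongrightarrow> l + 2 / \<alpha> * f l) at_bot"
  unfolding T_def by (intro S_at_bot N_at_bot S_profile N_profile)

section \<open>The equation truncated to an interval\<close>

text \<open>Extended endpoints let bounded intervals, half lines and the whole line share one
  equation. The interval is half-open so that truncation preserves right continuity.\<close>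

definition trunc :: "real \<Rightarrow> ereal \<Rightarrow> ereal \<Rightarrow> (real \<Rightarrow> real) \<Rightarrow> real \<Rightarrow> real" where
  "trunc c p q g z = (if ereal z < p then 0 else if q \<le> ereal z then 1 else T c g z)"

lemma trunc_profile: assumes "profile g" shows "profile (trunc c p q g)"
proof (rule profileI)
  note T = profileD[OF T_profile[OF assms, of c]]
  show "mono (trunc c p q g)"
  proof (rule monoI)
    fix x y :: real assume "x \<le> y"
    then have xy: "ereal x \<le> ereal y" by simp
    show "trunc c p q g x \<le> trunc c p q g y"
      using order_less_le_trans[OF _ xy] order_le_less_trans[OF xy] order_trans[OF _ xy] T(2)[OF \<open>x \<le> y\<close>] T(3,4)
      by (auto simp: trunc_def)
  qed
qed (use profileD(3,4)[OF T_profile[OF assms]] in \<open>auto simp: trunc_def\<close>)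

lemma trunc_mono:
  assumes "profile g" "profile h" "\<And>y. g y \<le> h y" shows "trunc c p q g z \<le> trunc c p q h z"
  using T_mono[OF assms] by (simp add: trunc_def)

lemma trunc_rcont: assumes "profile g" "rcont g" shows "rcont (trunc c p q g)"
proof (rule rcont_seqI)
  fix x :: real and y :: "nat \<Rightarrow> real" assume y: "y \<longlonglongrightarrow> x" "\<And>n. x < y n"
  then have y': "(\<lambda>n. ereal (y n)) \<longlonglongrightarrow> ereal x" by simp
  have le: "ereal x \<le> ereal (y n)" for n using y(2)[of n] by simp
  show "(\<lambda>n. trunc c p q g (y n)) \<longlonglongrightarrow> trunc c p q g x"
  proof (cases "ereal x < p")
    case True
    from order_tendstoD(2)[OF y' True] have "\<forall>\<^sub>F n in sequentially. trunc c p q g (y n) = 0"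
      by eventually_elim (simp add: trunc_def)
    then show ?thesis using True by (simp add: trunc_def tendsto_eventually)
  next
    case p: False
    then have p': "\<not> ereal (y n) < p" for n using le[of n] by (meson le_less_trans)
    show ?thesis
    proof (cases "q \<le> ereal x")
      case True
      then have "q \<le> ereal (y n)" for n using le[of n] by (rule order_trans)
      then show ?thesis using True p p' by (simp add: trunc_def)
    next
      case False
      then have "ereal x < q" by simp
      from order_tendstoD(2)[OF y' this] have ev: "\<forall>\<^sub>F n in sequentially. T c g (y n) = trunc c p q g (y n)"
        by eventually_elim (use p' in \<open>simp add: trunc_def not_le\<close>)
      have "(\<lambda>n. T c g (y n)) \<longlonglongrightarrow> T c g x"
        by (rule rcont_seqD[OF T_rcont[OF assms] y(1) less_imp_le[OF y(2)]])
      from Lim_transform_eventually[OF this ev] show ?thesis using False p by (simp add: trunc_def)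
    qed
  qed
qed

definition trunc_sol :: "real \<Rightarrow> ereal \<Rightarrow> ereal \<Rightarrow> (real \<Rightarrow> real) \<Rightarrow> bool" where
  "trunc_sol c p q g \<longleftrightarrow> profile g \<and> rcont g \<and> (\<forall>z. g z = trunc c p q g z)"

text \<open>Monotone iteration downwards from the supersolution \<open>g0\<close>: order
  preservation keeps the iterates decreasing and above the subsolution \<open>h\<close>, and
  dominated convergence passes the equation to the limit.\<close>

lemma trunc_sol_exists:
  assumes g0: "profile g0" "rcont g0" "\<And>z. trunc c p q g0 z \<le> g0 z"
    and h: "profile h" "\<And>z. h z \<le> g0 z" "\<And>z. h z \<le> trunc c p q h z"
  obtains g where "trunc_sol c p q g" "\<And>z. h z \<le> g z" "\<And>z. g z \<le> g0 z"
proof -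
  define G where "G n = (trunc c p q ^^ n) g0" for n
  have G0: "G 0 = g0" and GS: "G (Suc n) = trunc c p q (G n)" for n by (simp_all add: G_def)
  have G: "profile (G n) \<and> rcont (G n)" for n
    by (induction n) (auto simp: G0 GS g0 trunc_profile trunc_rcont)
  have dec1: "G (Suc n) z \<le> G n z" for n z
  proof (induction n arbitrary: z)
    case 0 show ?case using g0(3) by (simp add: G0 GS)
  next
    case (Suc n)
    show ?case unfolding GS[of "Suc n"] unfolding GS[of n]
      by (rule trunc_mono) (use G trunc_profile Suc GS in auto)
  qed
  then have dec: "decseq G" by (intro decseq_SucI) (simp add: le_fun_def)
  have hG: "h z \<le> G n z" for n z
  proof (induction n arbitrary: z)
    case 0 show ?case using h(2) by (simp add: G0)
  next
    case (Suc n)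
    have "h z \<le> trunc c p q h z" by (rule h(3))
    also have "\<dots> \<le> G (Suc n) z" unfolding GS by (rule trunc_mono) (use G h Suc in auto)
    finally show ?case .
  qed
  define g where "g z = (INF n. G n z)" for z
  have lim: "(\<lambda>n. G n z) \<longlonglongrightarrow> g z" for z unfolding g_def
  proof (rule LIMSEQ_decseq_INF)
    show "bdd_below (range (\<lambda>n. G n z))"
      using hG by (auto intro!: bdd_belowI[of _ "h z"])
    show "decseq (\<lambda>n. G n z)" using dec by (simp add: monotone_def le_fun_def)
  qed
  have hg: "h z \<le> g z" for z by (rule LIMSEQ_le_const[OF lim]) (use hG in auto)
  have gG: "g z \<le> G n z" for z n
    by (rule decseq_ge[OF _ lim]) (use dec in \<open>simp add: monotone_def le_fun_def\<close>)
  have prof: "profile g"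
  proof (rule profileI)
    show "mono g"
      by (rule monoI, rule LIMSEQ_le[OF lim lim]) (use G profileD(2) in blast)
    show "0 \<le> g z" for z using hg[of z] profileD(3)[OF h(1), of z] by simp
    show "g z \<le> 1" for z using gG[of z 0] profileD(4)[OF g0(1), of z] by (simp add: G0)
  qed
  have "rcont g" by (rule rcont_INF[OF _ _ dec prof lim]) (use G in auto)
  moreover have "g z = trunc c p q g z" for z
  proof (rule LIMSEQ_unique)
    show "(\<lambda>n. G (Suc n) z) \<longlonglongrightarrow> g z" using lim by (rule LIMSEQ_Suc)
    have "(\<lambda>n. T c (G n) z) \<longlonglongrightarrow> T c g z"
      by (rule T_tendsto_pointwise) (use G prof lim in auto)
    then show "(\<lambda>n. G (Suc n) z) \<longlonglongrightarrow> trunc c p q g z" by (auto simp: GS trunc_def)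
  qed
  ultimately show ?thesis using that[of g] prof hg gG[of _ 0] by (auto simp: trunc_sol_def G0)
qed

end

subsection \<open>Existence of waves\<close>

context bistable_chain
begin

text \<open>As \<open>c \<ge> 0\<close>, \<open>g\<close> is a subsolution of the standing problem
  too. Below \<theta> the term \<open>f\<close> is nonpositive, so the discrete Laplacian must be
  nonnegative; bounded convexity gives period 1, which contradicts distinct limits.\<close>

lemma no_sub_front:
  assumes g: "profile g" "\<And>z. g z \<le> T c g z" "(g \<longlongrightarrow> 0) at_bot" "(g \<longlongrightarrow> \<theta>) at_top" and "0 \<le> c"
  shows False
proof -
  have "0 \<le> g (z + 1) + g (z - 1) - 2 * g z" for z
  proof -
    have "g z \<le> \<theta>" by (rule mono_tendsto_at_top_le[OF profileD(1)[OF g(1)] g(4)])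
    then have "f (g z) \<le> 0"
      using f_neg[of "g z"] profileD(3)[OF g(1), of z] by (cases "g z = 0"; cases "g z = \<theta>") simp_all
    moreover have "g z \<le> N g z"
      using g(2)[of z] T_antimono_speed[OF g(1) assms(5), of z] by (simp add: T_zero)
    then have "0 \<le> 2 / \<alpha> * (g (z + 1) + g (z - 1) - 2 * g z + f (g z))" by (simp add: N_def)
    then have "0 \<le> g (z + 1) + g (z - 1) - 2 * g z + f (g z)"
      using alpha_pos by (simp add: zero_le_mult_iff zero_le_divide_iff)
    ultimately show ?thesis by linarith
  qed
  then have "g (z + 1) = g z" for z
    using mono_discrete_convex_periodic[of g] profileD(1,4)[OF g(1)] by blast
  from periodic_limits_eq[OF this g(3,4)] theta show False by simp
qed

lemma no_super_front:
  assumes g: "profile g" "\<And>z. T c g z \<le> g z" "(g \<longlongrightarrow> \<theta>) at_bot" "(g \<longlongrightarrow> 1) at_top" and "c \<le> 0"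
  shows False
proof -
  \<comment> \<open>Reflection turns the discretely concave \<open>g\<close> into a convex function
    that is still non-decreasing and bounded by 1.\<close>
  define h where "h z = 1 - g (- z)" for z
  have "0 \<le> h (z + 1) + h (z - 1) - 2 * h z" for z
  proof -
    define y where "y = - z"
    have "\<theta> \<le> g y" by (rule mono_tendsto_at_bot_ge[OF profileD(1)[OF g(1)] g(3)])
    then have "0 \<le> f (g y)"
      using f_pos[of "g y"] profileD(4)[OF g(1), of y] by (cases "g y = 1"; cases "g y = \<theta>") simp_all
    moreover have "N g y \<le> g y"
      using g(2)[of y] T_antimono_speed[OF g(1) assms(5), of y] by (simp add: T_zero)
    then have "2 / \<alpha> * (g (y + 1) + g (y - 1) - 2 * g y + f (g y)) \<le> 0" by (simp add: N_def)
    then have "g (y + 1) + g (y - 1) - 2 * g y + f (g y) \<le> 0"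
      using alpha_pos by (simp add: mult_le_0_iff divide_le_0_iff)
    moreover have "- (z + 1) = y - 1" "- (z - 1) = y + 1" by (simp_all add: y_def)
    then have "h (z + 1) = 1 - g (y - 1)" "h (z - 1) = 1 - g (y + 1)" "h z = 1 - g y"
      by (simp_all only: h_def y_def)
    ultimately show ?thesis by simp
  qed
  moreover have "mono h" using profileD(2)[OF g(1)] by (auto simp: mono_def h_def)
  moreover have "h z \<le> 1" for z using profileD(3)[OF g(1)] by (simp add: h_def)
  ultimately have per: "h (z + 1) = h z" for z using mono_discrete_convex_periodic[of h] by blast
  have "g (z + 1) = g z" for z using per[of "- z - 1"] by (simp add: h_def add.commute)
  from periodic_limits_eq[OF this g(3,4)] theta show False by simp
qed

definition front :: "real \<Rightarrow> ereal \<Rightarrow> ereal \<Rightarrow> (real \<Rightarrow> real) \<Rightarrow> bool" where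
  "front c p q g \<longleftrightarrow> trunc_sol c p q g \<and> (g \<longlongrightarrow> 0) at_bot \<and> (g \<longlongrightarrow> 1) at_top"

lemma trunc_solD:
  assumes "trunc_sol c p q g"
  shows "profile g" "rcont g" "ereal z < p \<Longrightarrow> g z = 0" "p \<le> ereal z \<Longrightarrow> q \<le> ereal z \<Longrightarrow> g z = 1"
    "p \<le> ereal z \<Longrightarrow> ereal z < q \<Longrightarrow> g z = T c g z"
proof -
  show "profile g" "rcont g" using assms by (auto simp: trunc_sol_def)
  have g: "g z = trunc c p q g z" using assms unfolding trunc_sol_def by blast
  show "ereal z < p \<Longrightarrow> g z = 0" "p \<le> ereal z \<Longrightarrow> q \<le> ereal z \<Longrightarrow> g z = 1"
    "p \<le> ereal z \<Longrightarrow> ereal z < q \<Longrightarrow> g z = T c g z"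
    by (subst g, auto simp: trunc_def)+
qed

lemma trunc_sol_shift:
  assumes "trunc_sol c p q g"
  shows "trunc_sol c (p - ereal s) (q - ereal s) (\<lambda>z. g (z + s))"
proof -
  have "ereal z < p - ereal s \<longleftrightarrow> ereal (z + s) < p" for z by (cases p) auto
  moreover have "q - ereal s \<le> ereal z \<longleftrightarrow> q \<le> ereal (z + s)" for z by (cases q) auto
  ultimately have eq: "trunc c (p - ereal s) (q - ereal s) (\<lambda>z. g (z + s)) z = trunc c p q g (z + s)" for z
    by (simp add: trunc_def T_shift)
  have "rcont (\<lambda>z. g (z + s))"
  proof (rule rcont_seqI)
    fix x :: real and y :: "nat \<Rightarrow> real" assume y: "y \<longlonglongrightarrow> x" "\<And>n. x < y n"
    show "(\<lambda>n. g (y n + s)) \<longlonglongrightarrow> g (x + s)"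
    proof (rule rcont_seqD[OF trunc_solD(2)[OF assms]])
      show "(\<lambda>n. y n + s) \<longlonglongrightarrow> x + s" by (intro tendsto_intros y)
      show "x + s \<le> y n + s" for n using y(2)[of n] by simp
    qed
  qed
  then show ?thesis
    using assms profile_shift[OF trunc_solD(1)[OF assms]] unfolding trunc_sol_def eq by blast
qed

text \<open>Locates the crossing of level \<open>a\<close>. As \<open>g\<close> is 0 before
  \<open>p\<close> and 1 beyond \<open>q\<close>, the crossing lies between the ends, so translating
  it to 0 leaves 0 between the translated ends.\<close>

lemma front_normalise:
  assumes front: "front c p q g" and "p \<le> q" "0 < a" "a < 1"
  obtains s where "p \<le> ereal s" "ereal s \<le> q" "a \<le> g s" "\<And>z. z < s \<Longrightarrow> g z \<le> a"
proof -
  have sol: "trunc_sol c p q g" and bot: "(g \<longlongrightarrow> 0) at_bot" and top: "(g \<longlongrightarrow> 1) at_top"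
    using front by (auto simp: front_def)
  note g = trunc_solD[OF sol]
  define s where "s = Inf {z. a \<le> g z}"
  from order_tendstoD(1)[OF top assms(4)] obtain z1 where z1: "a < g z1"
    by (auto simp: eventually_at_top_linorder)
  from order_tendstoD(2)[OF bot assms(3)] obtain z0 where z0: "g z0 < a"
    by (auto simp: eventually_at_bot_linorder)
  have bdd: "bdd_below {z. a \<le> g z}"
  proof (rule bdd_belowI)
    fix z assume "z \<in> {z. a \<le> g z}"
    then have "\<not> z \<le> z0" using z0 profileD(2)[OF g(1), of z z0] by fastforce
    then show "z0 \<le> z" by simp
  qed
  have below: "g z < a" if "z < s" for z
  proof (rule ccontr)
    assume "\<not> g z < a"
    then have "s \<le> z" unfolding s_def by (intro cInf_lower bdd) simp
    then show False using that by simp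
  qed
  have above: "a \<le> g y" if sy: "s < y" for y
  proof -
    have "{z. a \<le> g z} \<noteq> {}" using less_imp_le[OF z1] by blast
    from cInf_less_iff[OF this bdd, of y] sy obtain z where "a \<le> g z" "z < y"
      unfolding s_def by (elim iffE impE) (assumption, auto)
    then show ?thesis using profileD(2)[OF g(1), of z y] by simp
  qed
  have "(\<lambda>n. g (s + 1 / real (Suc n))) \<longlonglongrightarrow> g s"
  proof (rule rcont_seqD[OF g(2)])
    have "(\<lambda>n. s + 1 / real (Suc n)) \<longlonglongrightarrow> s + 0" by (intro tendsto_add tendsto_const) real_asymp
    then show "(\<lambda>n. s + 1 / real (Suc n)) \<longlonglongrightarrow> s" by simp
  qed simp
  then have as: "a \<le> g s"
    by (rule LIMSEQ_le_const) (auto intro!: exI[of _ 0] above)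
  show ?thesis
  proof
    show "p \<le> ereal s"
    proof (rule ccontr)
      assume "\<not> p \<le> ereal s"
      then have "g s = 0" using g(3)[of s] by simp
      then show False using as assms(3) by simp
    qed
    show "ereal s \<le> q"
    proof (rule ccontr)
      assume "\<not> ereal s \<le> q"
      then have "q < ereal s" by simp
      from ereal_dense2[OF this] obtain z where "q < ereal z" "ereal z < ereal s" by blast
      then have "g z = 1" "g z < a" using assms(2) by (auto intro!: g(4) below)
      then show False using assms(4) by simp
    qed
  qed (use as below in \<open>auto intro: less_imp_le\<close>)
qed

text \<open>Helly's theorem handles the functions and compactness of the extended reals the
  endpoints. The limit equation is first obtained off a countable set and then everywhere by right
  continuity; the crossing at 0 survives the limit.\<close>

lemma trunc_sol_compact:
  assumes sol: "\<And>n. trunc_sol (c n) (p n) (q n) (g n)"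
    and pq: "\<And>n. p n \<le> 0" "\<And>n. 0 \<le> q n"
    and a: "\<And>n. a \<le> g n 0" "\<And>n z. z < 0 \<Longrightarrow> g n z \<le> a" and c: "c \<longlonglongrightarrow> c'"
  obtains r p' q' h where "strict_mono r" "(\<lambda>n. p (r n)) \<longlonglongrightarrow> p'" "(\<lambda>n. q (r n)) \<longlonglongrightarrow> q'"
    "p' \<le> 0" "0 \<le> q'" "trunc_sol c' p' q' h" "a \<le> h 0" "\<forall>z<0. h z \<le> a"
proof -
  note g = trunc_solD[OF sol]
  have "\<bar>g n z\<bar> \<le> 1" for n z using profileD(3,4)[OF g(1)[of n]] by simp
  then have "\<exists>s. strict_mono (s :: nat \<Rightarrow> nat) \<and> (\<exists>F. (\<forall>x. continuous (at_right x) F) \<and> mono F \<and>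
      (\<forall>x. \<bar>F x\<bar> \<le> 1) \<and> (\<forall>x. continuous (at x) F \<longrightarrow> (\<lambda>n. g (s n) x) \<longlonglongrightarrow> F x))"
    using g(2) profileD(1)[OF g(1)] by (intro Helly_selection) (auto simp: rcont_def)
  then
  obtain r1 h where r1: "strict_mono (r1 :: nat \<Rightarrow> nat)" and h: "rcont h" "mono h" "\<And>z. \<bar>h z\<bar> \<le> 1"
    and lim1: "\<And>z. isCont h z \<Longrightarrow> (\<lambda>n. g (r1 n) z) \<longlonglongrightarrow> h z"
    unfolding rcont_def by blast
  obtain r2 p' where r2: "strict_mono (r2 :: nat \<Rightarrow> nat)" "((\<lambda>n. p (r1 n)) \<circ> r2) \<longlonglongrightarrow> p'"
    using compact_complete_linorder[of "\<lambda>n. p (r1 n)"] by blast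
  obtain r3 q' where r3: "strict_mono (r3 :: nat \<Rightarrow> nat)" "((\<lambda>n. q (r1 (r2 n))) \<circ> r3) \<longlonglongrightarrow> q'"
    using compact_complete_linorder[of "\<lambda>n. q (r1 (r2 n))"] by blast
  define r where "r n = r1 (r2 (r3 n))" for n
  have r: "strict_mono r" using r1 r2(1) r3(1) by (auto simp: strict_mono_def r_def)
  have plim: "(\<lambda>n. p (r n)) \<longlonglongrightarrow> p'"
    using LIMSEQ_subseq_LIMSEQ[OF r2(2) r3(1)] by (simp add: o_def r_def)
  have qlim: "(\<lambda>n. q (r n)) \<longlonglongrightarrow> q'" using r3(2) by (simp add: o_def r_def)
  have clim: "(\<lambda>n. c (r n)) \<longlonglongrightarrow> c'" using LIMSEQ_subseq_LIMSEQ[OF c r] by (simp add: o_def)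
  have r23: "strict_mono (\<lambda>n. r2 (r3 n))" using r2(1) r3(1) by (auto simp: strict_mono_def)
  have lim: "(\<lambda>n. g (r n) z) \<longlonglongrightarrow> h z" if "isCont h z" for z
    using LIMSEQ_subseq_LIMSEQ[OF lim1[OF that] r23] by (simp add: o_def r_def)
  define D where "D = {z. \<not> isCont h z}"
  have D: "countable D" unfolding D_def by (rule mono_ctble_discont[OF h(2)])
  have limD: "(\<lambda>n. g (r n) z) \<longlonglongrightarrow> h z" if "z \<notin> D" for z using that lim by (simp add: D_def)
  have h_prof: "profile h"
  proof (rule profileI[OF h(2)])
    fix z
    obtain y where y: "y < z" "y \<notin> D" by (rule countable_dense[OF D, of "z - 1" z]) auto
    have "0 \<le> h y" by (rule LIMSEQ_le_const[OF limD[OF y(2)]]) (use profileD(3)[OF g(1)] in auto)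
    then show "0 \<le> h z" using y(1) h(2) by (meson less_imp_le monoD order_trans)
    show "h z \<le> 1" using h(3)[of z] by simp
  qed
  obtain Y where Y: "countable Y" "\<And>z. z \<notin> Y \<Longrightarrow> (\<lambda>n. T (c (r n)) (g (r n)) z) \<longlonglongrightarrow> T c' h z"
    by (rule T_tendsto_countable[OF g(1) h_prof D limD clim]) auto
  have trunc_eq: "h x = trunc c' p' q' h x" for x
  proof (rule rcont_eqI[OF h(1) trunc_rcont[OF h_prof h(1)]])
    \<comment> \<open>The endpoints are excluded because there the active case of the truncation
      need not stabilise along the sequence. For an infinite endpoint \<open>real_of_ereal\<close>
      returns 0, which only excludes one more point.\<close>
    show "countable (D \<union> Y \<union> {real_of_ereal p', real_of_ereal q'})" using D Y(1) by simp
    show "x < x + 1" by simp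
    fix z assume z: "z \<notin> D \<union> Y \<union> {real_of_ereal p', real_of_ereal q'}"
    then have ne: "ereal z \<noteq> p'" "ereal z \<noteq> q'" by auto
    note hz = limD[of z]
    show "h z = trunc c' p' q' h z"
    proof (cases "ereal z < p'")
      case True
      from order_tendstoD(1)[OF plim True] have "\<forall>\<^sub>F n in sequentially. g (r n) z = 0"
        by eventually_elim (rule g(3))
      then have "(\<lambda>n. g (r n) z) \<longlonglongrightarrow> 0" by (simp add: tendsto_eventually)
      then show ?thesis using LIMSEQ_unique hz z True by (auto simp: trunc_def)
    next
      case False
      then have p: "p' < ereal z" using ne by auto
      note evp = order_tendstoD(2)[OF plim p]
      show ?thesis
      proof (cases "q' < ereal z")
        case True
        from order_tendstoD(2)[OF qlim True] evp have "\<forall>\<^sub>F n in sequentially. g (r n) z = 1"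
          by eventually_elim (auto intro!: g(4) less_imp_le)
        then have "(\<lambda>n. g (r n) z) \<longlonglongrightarrow> 1" by (simp add: tendsto_eventually)
        then have "h z = 1" using LIMSEQ_unique hz z by auto
        then show ?thesis using True False by (auto simp: trunc_def)
      next
        case q: False
        then have "ereal z < q'" using ne by auto
        from order_tendstoD(1)[OF qlim this] evp
        have "\<forall>\<^sub>F n in sequentially. T (c (r n)) (g (r n)) z = g (r n) z"
          by eventually_elim (auto intro!: g(5)[symmetric] less_imp_le)
        from Lim_transform_eventually[OF Y(2) this] have "(\<lambda>n. g (r n) z) \<longlonglongrightarrow> T c' h z" using z by auto
        then have "h z = T c' h z" using LIMSEQ_unique hz z by auto
        then show ?thesis using False \<open>ereal z < q'\<close> by (auto simp: trunc_def)
      qed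
    qed
  qed
  have h0: "h z \<le> a" if neg: "z < 0" for z
  proof -
    obtain y where y: "z < y" "y < 0" "y \<notin> D" by (rule countable_dense[OF D neg]) auto
    have "h y \<le> a" by (rule LIMSEQ_le_const2[OF limD[OF y(3)]]) (use a(2) y(2) in auto)
    then show ?thesis using y(1) h(2) by (meson less_imp_le monoD order_trans)
  qed
  have ah: "a \<le> h y" if pos: "0 < y" for y
  proof -
    obtain w where w: "0 < w" "w < y" "w \<notin> D" by (rule countable_dense[OF D pos]) auto
    have "a \<le> g (r n) w" for n
      using a(1)[of "r n"] profileD(2)[OF g(1)[of "r n"], of 0 w] w(1) by simp
    then have "a \<le> h w" by (intro LIMSEQ_le_const[OF limD[OF w(3)]]) auto
    then show ?thesis using w(2) h(2) by (meson less_imp_le monoD order_trans)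
  qed
  have "(\<lambda>n. h (1 / real (Suc n))) \<longlonglongrightarrow> h 0"
    by (rule rcont_seqD[OF h(1)]) (real_asymp, simp)
  then have "a \<le> h 0"
    by (rule LIMSEQ_le_const) (auto intro!: exI[of _ 0] ah)
  moreover have "p' \<le> 0" by (rule LIMSEQ_le_const2[OF plim]) (use pq in auto)
  moreover have "0 \<le> q'" by (rule LIMSEQ_le_const[OF qlim]) (use pq in auto)
  moreover have "trunc_sol c' p' q' h" using h_prof h(1) trunc_eq by (auto simp: trunc_sol_def)
  ultimately show ?thesis using that r plim qlim h0 by blast
qed

text \<open>With this choice of the level no front connecting to \<open>\<theta>\<close> can arise in the limit.\<close>

definition level :: "real \<Rightarrow> real" where
  "level c = (if 0 \<le> c then \<theta> / 2 else (1 + \<theta>) / 2)"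

lemma level: "0 < level c" "level c < 1" "level c \<noteq> \<theta>"
  using theta by (auto simp: level_def)

text \<open>At a finite end the limit is the prescribed value; at an infinite end, passing to the
  limit in \<open>g = T c g\<close> makes it a zero of \<open>f\<close>. The intermediate zero
  \<theta> is then excluded on one side by the level and on the other by the absence of half
  fronts.\<close>

lemma trunc_sol_front:
  assumes sol: "trunc_sol c p q g" and p: "p \<le> 0" and q: "0 \<le> q"
    and a: "level c \<le> g 0" "\<And>z. z < 0 \<Longrightarrow> g z \<le> level c"
  shows "front c p q g"
proof -
  note g = trunc_solD[OF sol]
  obtain l where l: "(g \<longlongrightarrow> l) at_bot" "\<And>z. l \<le> g z" "0 \<le> l" "l \<le> 1" using profile_lim_at_bot[OF g(1)] by blast
  obtain u where u: "(g \<longlongrightarrow> u) at_top" "\<And>z. g z \<le> u" "u \<le> 1" "0 \<le> u" using profile_lim_at_top[OF g(1)] by blast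
  have l_cases: "l = 0 \<or> p = -\<infinity> \<and> f l = 0"
  proof (cases p)
    case (real x)
    have "\<forall>\<^sub>F z in at_bot. g z = 0"
      using eventually_gt_at_bot[of x] by eventually_elim (rule g(3), simp add: real)
    then have "(g \<longlongrightarrow> 0) at_bot" by (simp add: tendsto_eventually)
    from tendsto_unique[OF trivial_limit_at_bot_linorder this l(1)] show ?thesis by simp
  next
    case MInf
    have "\<forall>\<^sub>F z in at_bot. T c g z = g z"
      using eventually_gt_at_bot[of "0 :: real"]
    proof eventually_elim
      case (elim z)
      then have "ereal z < 0" by (simp add: zero_ereal_def)
      then have "ereal z < q" using q by (rule less_le_trans)
      then show ?case using g(5)[of z] MInf by simp
    qed
    from tendsto_unique[OF trivial_limit_at_bot_linorder Lim_transform_eventually[OF T_at_bot[OF g(1) l(1)] this] l(1)]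
    have "l + 2 / \<alpha> * f l = l" .
    then show ?thesis using alpha_pos MInf by simp
  qed (use p in auto)
  have pz: "p \<le> ereal z" if "0 < z" for z
    by (rule order_trans[OF p]) (use that in simp)
  have u_cases: "u = 1 \<or> q = \<infinity> \<and> f u = 0"
  proof (cases q)
    case (real x)
    have "\<forall>\<^sub>F z in at_top. g z = 1"
      using eventually_gt_at_top[of x] eventually_gt_at_top[of 0]
      by eventually_elim (rule g(4), use pz real in auto)
    then have "(g \<longlongrightarrow> 1) at_top" by (simp add: tendsto_eventually)
    from tendsto_unique[OF trivial_limit_at_top_linorder this u(1)] show ?thesis by simp
  next
    case PInf
    have "\<forall>\<^sub>F z in at_top. T c g z = g z"
      using eventually_gt_at_top[of 0]
    proof eventually_elim
      case (elim z)
      then have "p \<le> ereal z" by (rule pz)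
      then show ?case using g(5)[of z] PInf by simp
    qed
    from tendsto_unique[OF trivial_limit_at_top_linorder Lim_transform_eventually[OF T_at_top[OF g(1) u(1)] this] u(1)]
    have "u + 2 / \<alpha> * f u = u" .
    then show ?thesis using alpha_pos PInf by simp
  qed (use q in auto)
  have l_lev: "l \<le> level c" using l(2)[of "-1"] a(2)[of "-1"] by simp
  have u_lev: "level c \<le> u" using u(2)[of 0] a(1) by simp
  have l3: "l = 0 \<or> l = \<theta>" using l_cases f_zeros[of l] l l_lev level(2)[of c] by auto
  have u3: "u = \<theta> \<or> u = 1" using u_cases f_zeros[of u] u u_lev level(1)[of c] by auto
  have "l = 0 \<and> u = 1"
  \<comment> \<open>For \<open>c \<ge> 0\<close> the level lies below \<theta>, so only the right
    limit could be \<theta>; for \<open>c < 0\<close> it lies above, so only the left limit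
    could.\<close>
  proof (cases "0 \<le> c")
    case True
    then have l0: "l = 0" using l3 l_lev theta by (auto simp: level_def)
    have "u \<noteq> \<theta>"
    proof
      assume u\<theta>: "u = \<theta>"
      then have "q = \<infinity>" using u_cases theta by auto
      then have "g z \<le> T c g z" for z
        using g(3,5)[of z] profileD(3)[OF T_profile[OF g(1)], of c z] by (cases "ereal z < p") auto
      with no_sub_front[OF g(1) _ _ _ True] l u l0 u\<theta> show False by blast
    qed
    then show ?thesis using l0 u3 by simp
  next
    case False
    then have u1: "u = 1" using u3 u_lev theta by (auto simp: level_def)
    have "l \<noteq> \<theta>"
    proof
      assume l\<theta>: "l = \<theta>"
      then have "p = -\<infinity>" using l_cases theta by auto
      then have "T c g z \<le> g z" for z
        using g(4,5)[of z] profileD(4)[OF T_profile[OF g(1)], of c z] by (cases "q \<le> ereal z") auto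
      with no_super_front[OF g(1) _ _ _] False l u u1 l\<theta> show False by (metis linorder_le_cases)
    qed
    then show ?thesis using u1 l3 by simp
  qed
  then show ?thesis using l u sol by (simp add: front_def)
qed

text \<open>Each front is translated so that it crosses \<open>level c'\<close> at 0. The level
  belongs to the limit speed, since it is the limit that must be shown to connect 0 and 1.\<close>

lemma front_closed:
  assumes front: "\<And>n. front (c n) (p n) (q n) (g n)" and pq: "\<And>n. p n \<le> q n" and c: "c \<longlonglongrightarrow> c'"
  obtains r s p' q' h where "strict_mono r" "(\<lambda>n. p (r n) - ereal (s n)) \<longlonglongrightarrow> p'"
    "(\<lambda>n. q (r n) - ereal (s n)) \<longlonglongrightarrow> q'" "p' \<le> 0" "0 \<le> q'" "front c' p' q' h"
proof -
  have "\<exists>s. p n \<le> ereal s \<and> ereal s \<le> q n \<and> level c' \<le> g n s \<and> (\<forall>z<s. g n z \<le> level c')" for n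
    by (rule front_normalise[OF front pq level(1,2)]) blast
  then obtain s where s: "\<And>n. p n \<le> ereal (s n)" "\<And>n. ereal (s n) \<le> q n"
    "\<And>n. level c' \<le> g n (s n)" "\<And>n z. z < s n \<Longrightarrow> g n z \<le> level c'" by metis
  define G where "G n z = g n (z + s n)" for n z
  have sol: "trunc_sol (c n) (p n - ereal (s n)) (q n - ereal (s n)) (G n)" for n
    unfolding G_def by (rule trunc_sol_shift) (use front in \<open>simp add: front_def\<close>)
  have p0: "p n - ereal (s n) \<le> 0" for n using s(1)[of n] by (cases "p n") auto
  have q0: "0 \<le> q n - ereal (s n)" for n using s(2)[of n] by (cases "q n") auto
  have G0: "level c' \<le> G n 0" "z < 0 \<Longrightarrow> G n z \<le> level c'" for n z
    using s(3,4) by (auto simp: G_def)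
  obtain r p' q' h where "strict_mono r" "(\<lambda>n. p (r n) - ereal (s (r n))) \<longlonglongrightarrow> p'"
    "(\<lambda>n. q (r n) - ereal (s (r n))) \<longlonglongrightarrow> q'" "p' \<le> 0" "0 \<le> q'"
    "trunc_sol c' p' q' h" "level c' \<le> h 0" "\<forall>z<0. h z \<le> level c'"
    by (rule trunc_sol_compact[OF sol p0 q0 G0 c]) blast
  then show ?thesis using that[of r "\<lambda>n. s (r n)" p' q' h] trunc_sol_front by blast
qed

section \<open>Classification of the speeds\<close>

text \<open>A front on a right half line is zero left of \<open>p\<close>, hence a subsolution of
  the equation on the whole line; dually, the fronts of \<open>super_speed\<close> are
  supersolutions.\<close>

definition sub_speed :: "real \<Rightarrow> bool" where
  "sub_speed c \<longleftrightarrow> (\<exists>p g. front c (ereal p) \<infinity> g)"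

definition super_speed :: "real \<Rightarrow> bool" where
  "super_speed c \<longleftrightarrow> (\<exists>q g. front c (-\<infinity>) (ereal q) g)"

definition wave_speed :: "real \<Rightarrow> bool" where
  "wave_speed c \<longleftrightarrow> (\<exists>g. front c (-\<infinity>) \<infinity> g)"

lemma trunc_inf: "trunc c (-\<infinity>) \<infinity> g = T c g"
  by (simp add: trunc_def fun_eq_iff)

text \<open>Fronts on \<open>[0, n + 1)\<close> always exist, since the constants 0 and 1 are a
  subsolution and a supersolution. In the normalised limit at least one end escapes to infinity, and
  which ends escape decides the case.\<close>

lemma speed_trichotomy: "sub_speed c \<or> super_speed c \<or> wave_speed c"
proof -
  have const: "profile (\<lambda>_. 1)" "profile (\<lambda>_. 0)" "rcont (\<lambda>_. 1)"
    by (auto simp: profile_def mono_def intro: continuous_imp_rcont)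
  have "\<exists>g. front c 0 (ereal (real n + 1)) g" for n
  proof -
    obtain g where g: "trunc_sol c 0 (ereal (real n + 1)) g"
      by (rule trunc_sol_exists[OF const(1,3) _ const(2), of c 0 "ereal (real n + 1)"])
        (use profileD(3,4)[OF trunc_profile] const in auto)
    have "\<forall>\<^sub>F z in at_bot. g z = 0"
      using eventually_gt_at_bot[of 0] by eventually_elim (rule trunc_solD(3)[OF g], simp add: zero_ereal_def)
    moreover have "\<forall>\<^sub>F z in at_top. g z = 1"
      using eventually_gt_at_top[of "real n + 1"]
      by eventually_elim (rule trunc_solD(4)[OF g], auto simp: zero_ereal_def)
    ultimately show ?thesis using g by (auto simp: front_def tendsto_eventually)
  qed
  then obtain g where g: "\<And>n. front c 0 (ereal (real n + 1)) (g n)" by metis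
  obtain r s p q h where r: "strict_mono r"
    and p: "(\<lambda>n. 0 - ereal (s n)) \<longlonglongrightarrow> p" and q: "(\<lambda>n. ereal (real (r n) + 1) - ereal (s n)) \<longlonglongrightarrow> q"
    and pq: "p \<le> 0" "0 \<le> q" and h: "front c p q h"
    by (rule front_closed[OF g _ tendsto_const]) (auto simp: zero_ereal_def)
  \<comment> \<open>If both ends stayed finite, the interval lengths \<open>real (r n) + 1\<close>
    would converge.\<close>
  have "p = -\<infinity> \<or> q = \<infinity>"
  proof (rule ccontr)
    assume "\<not> ?thesis"
    then obtain x y where xy: "p = ereal x" "q = ereal y" using pq by (cases p; cases q) auto
    have "(\<lambda>n. - s n) \<longlonglongrightarrow> x" using p xy by (simp add: zero_ereal_def)
    moreover have "(\<lambda>n. real (r n) + 1 - s n) \<longlonglongrightarrow> y" using q xy by simp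
    ultimately have "(\<lambda>n. real (r n) + 1 - s n - (- s n)) \<longlonglongrightarrow> y - x" by (intro tendsto_diff)
    then have "(\<lambda>n. real (r n) + 1) \<longlonglongrightarrow> y - x" by simp
    moreover have "filterlim (\<lambda>n. real (r n) + 1) at_top sequentially"
      using filterlim_tendsto_add_at_top[OF tendsto_const filterlim_compose[OF filterlim_real_sequentially filterlim_subseq[OF r]], of 1]
      by (simp add: add.commute)
    ultimately show False
      using not_tendsto_and_filterlim_at_infinity[OF sequentially_bot] filterlim_at_top_imp_at_infinity by blast
  qed
  then show ?thesis using h pq
    by (cases p; cases q) (auto simp: sub_speed_def super_speed_def wave_speed_def)
qed

text \<open>The right end stays infinite in the limit. The left end either stays finite or escapes,
  and in the latter case the limit is a front on the whole line.\<close>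

lemma sub_speed_closed:
  assumes "\<And>n. sub_speed (c n)" "c \<longlonglongrightarrow> c'" shows "sub_speed c' \<or> wave_speed c'"
proof -
  obtain p g where g: "\<And>n. front (c n) (ereal (p n)) \<infinity> (g n)" using assms(1) unfolding sub_speed_def by metis
  obtain r s p' q' h where "(\<lambda>n. ereal (p (r n)) - ereal (s n)) \<longlonglongrightarrow> p'" 
    and q: "(\<lambda>n. \<infinity> - ereal (s n)) \<longlonglongrightarrow> q'" and p: "p' \<le> 0" and h: "front c' p' q' h"
    by (rule front_closed[OF g _ assms(2)]) auto
  have "q' = \<infinity>" using LIMSEQ_unique[OF q] by auto
  then show ?thesis using h p by (cases p') (auto simp: sub_speed_def wave_speed_def)
qed

lemma super_speed_closed:
  assumes "\<And>n. super_speed (c n)" "c \<longlonglongrightarrow> c'" shows "super_speed c' \<or> wave_speed c'"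
proof -
  obtain q g where g: "\<And>n. front (c n) (-\<infinity>) (ereal (q n)) (g n)" using assms(1) unfolding super_speed_def by metis
  obtain r s p' q' h where "(\<lambda>n. ereal (q (r n)) - ereal (s n)) \<longlonglongrightarrow> q'" 
    and p: "(\<lambda>n. -\<infinity> - ereal (s n)) \<longlonglongrightarrow> p'" and q: "0 \<le> q'" and h: "front c' p' q' h"
    by (rule front_closed[OF g _ assms(2)]) auto
  have "p' = -\<infinity>" using LIMSEQ_unique[OF p] by auto
  then show ?thesis using h q by (cases q') (auto simp: super_speed_def wave_speed_def)
qed

text \<open>After translation the left front \<open>g\<close> and the right front \<open>h\<close>
  are ordered, and monotone iteration yields a solution between them. It inherits the limit 0 from
  above and the limit 1 from below.\<close>

lemma sub_super_wave:
  assumes "sub_speed c" "super_speed c" shows "wave_speed c"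
proof -
  obtain p g where g: "front c (ereal p) \<infinity> g" using assms(1) by (auto simp: sub_speed_def)
  obtain q h0 where h0: "front c (-\<infinity>) (ereal q) h0" using assms(2) by (auto simp: super_speed_def)
  from g have "trunc_sol c (ereal p) \<infinity> g" by (simp add: front_def)
  note gs = trunc_solD[OF this]
  \<comment> \<open>The shift moves the end \<open>q\<close> onto \<open>p\<close>, so at every
    point either \<open>g = 0\<close> or \<open>h = 1\<close>.\<close>
  define h where "h z = h0 (z + (q - p))" for z
  have h: "trunc_sol c (-\<infinity>) (ereal p) h"
    using trunc_sol_shift[of c "-\<infinity>" "ereal q" h0 "q - p"] h0 by (simp add: h_def[abs_def] front_def)
  note hs = trunc_solD[OF h]
  have "g z \<le> h z" for z
    using gs(3)[of z] profileD(3,4)[OF hs(1)] profileD(4)[OF gs(1), of z] hs(4)[of z]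
    by (cases "z < p") auto
  moreover have "g z \<le> trunc c (-\<infinity>) \<infinity> g z" for z
    using gs(3,5)[of z] profileD(3)[OF T_profile[OF gs(1)]] by (cases "z < p") (auto simp: trunc_inf)
  moreover have "trunc c (-\<infinity>) \<infinity> h z \<le> h z" for z
    using hs(4,5)[of z] profileD(4)[OF T_profile[OF hs(1)]] by (cases "z < p") (auto simp: trunc_inf)
  ultimately obtain k where k: "trunc_sol c (-\<infinity>) \<infinity> k" "\<And>z. g z \<le> k z" "\<And>z. k z \<le> h z"
    using trunc_sol_exists[OF hs(1,2) _ gs(1)] by blast
  have "(h \<longlongrightarrow> 0) at_bot"
  proof -
    have "filterlim (\<lambda>z. (q - p) + z) at_bot (at_bot :: real filter)"
      by (simp only: filterlim_tendsto_add_at_bot_iff[OF tendsto_const] filterlim_ident)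
    moreover have "(h0 \<longlongrightarrow> 0) at_bot" using h0 by (simp add: front_def)
    ultimately have "((\<lambda>z. h0 ((q - p) + z)) \<longlongrightarrow> 0) at_bot" by (rule filterlim_compose[rotated])
    then show ?thesis by (simp add: h_def[abs_def] add.commute)
  qed
  then have "(k \<longlongrightarrow> 0) at_bot"
    by (rule tendsto_sandwich[OF _ _ tendsto_const, rotated 2])
      (use k(3) profileD(3)[OF trunc_solD(1)[OF k(1)]] in \<open>auto intro!: always_eventually\<close>)
  moreover have "(g \<longlongrightarrow> 1) at_top" using g by (simp add: front_def)
  then have "(k \<longlongrightarrow> 1) at_top"
    by (rule tendsto_sandwich[OF _ _ _ tendsto_const, rotated 2])
      (use k(2) profileD(4)[OF trunc_solD(1)[OF k(1)]] in \<open>auto intro!: always_eventually\<close>)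
  ultimately show ?thesis using k(1) by (auto simp: wave_speed_def front_def)
qed

section \<open>Excluding extreme speeds\<close>

text \<open>For \<open>k \<ge> 0\<close> this is the Laplace transform of the exponential law at
  \<open>k\<close>; the cutoff by 1 acts only on the null set of negative \<open>s\<close> and makes
  the integrand bounded.\<close>

definition weight :: "real \<Rightarrow> real" where
  "weight k = (\<integral>s. min 1 (exp (- (k * s))) \<partial>E)"

lemma integrable_weight: "integrable E (\<lambda>s. min 1 (exp (- (k * s))))"
  by (rule E.integrable_const_bound[where B = 1]) auto

lemma weight_nonneg: "0 \<le> weight k" by (simp add: weight_def)

lemma weight_small: assumes "0 < e" obtains k where "0 < k" "weight k < e"
proof -
  have "(\<lambda>n. weight (real n)) \<longlonglongrightarrow> (\<integral>s. 0 \<partial>E)" unfolding weight_def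
  proof (rule E_tendsto)
    show "AE s in E. (\<lambda>n. min 1 (exp (- (real n * s)))) \<longlonglongrightarrow> 0"
      using AE_E_pos
    proof eventually_elim
      case (elim s)
      then have "(\<lambda>n. exp (- (real n * s))) \<longlonglongrightarrow> 0" by real_asymp
      from tendsto_min[OF tendsto_const[of 1] this] show ?case by simp
    qed
  qed auto
  then have "\<forall>\<^sub>F n in sequentially. weight (real n) < e" using order_tendstoD(2)[OF _ assms] by simp
  with eventually_gt_at_top[of 0] obtain n :: nat where "0 < n" "weight (real n) < e"
    using eventually_happens[OF eventually_conj] by (metis (no_types, lifting) sequentially_bot)
  then show ?thesis using that[of "real n"] by simp
qed

text \<open>Exponentials are eigenfunctions of the average, with eigenvalue
  \<open>weight (\<sigma> * c)\<close>. The choice \<open>\<sigma> = 1\<close> controls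
  \<open>g\<close> near the left end, \<open>\<sigma> = -1\<close> controls \<open>1 - g\<close>
  near the right end.\<close>

lemma S_exp_bound:
  assumes [measurable]: "g \<in> borel_measurable borel" and g: "\<And>y. 0 \<le> g y" "\<And>y. g y \<le> 1"
    "\<And>y. g y \<le> A * exp (\<sigma> * y)" and k: "k = \<sigma> * c" "0 < k" and A: "0 \<le> A"
  shows "(\<integral>s. g (z - c * s) \<partial>E) \<le> A * weight k * exp (\<sigma> * z)"
proof -
  have "(\<integral>s. g (z - c * s) \<partial>E) \<le> (\<integral>s. A * exp (\<sigma> * z) * min 1 (exp (- (k * s))) \<partial>E)"
  proof (rule integral_mono_AE)
    show "integrable E (\<lambda>s. g (z - c * s))"
      by (rule E.integrable_const_bound[where B = 1]) (use g in auto)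
    show "integrable E (\<lambda>s. A * exp (\<sigma> * z) * min 1 (exp (- (k * s))))"
      by (intro integrable_mult_right integrable_weight)
    show "AE s in E. g (z - c * s) \<le> A * exp (\<sigma> * z) * min 1 (exp (- (k * s)))"
      using AE_E_pos
    proof eventually_elim
      case (elim s)
      then have "exp (- (k * s)) \<le> 1" using k(2) by simp
      then have "min 1 (exp (- (k * s))) = exp (- (k * s))" by simp
      moreover have "exp (\<sigma> * (z - c * s)) = exp (\<sigma> * z) * exp (- (k * s))"
        by (simp add: k(1) exp_add[symmetric] algebra_simps)
      ultimately show ?case using g(3)[of "z - c * s"] by (simp add: mult.assoc)
    qed
  qed
  then show ?thesis by (simp add: weight_def mult_ac)
qed

lemma exp_halving:
  fixes u :: "real \<Rightarrow> real"
  assumes "0 \<le> C" "\<And>z. u z \<le> C * exp (\<sigma> * z)"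
    and "\<And>A z. 0 \<le> A \<Longrightarrow> (\<And>y. u y \<le> A * exp (\<sigma> * y)) \<Longrightarrow> u z \<le> A / 2 * exp (\<sigma> * z)"
  shows "u z \<le> 0"
proof -
  have "u z \<le> C / 2 ^ n * exp (\<sigma> * z)" for n z
  proof (induction n arbitrary: z)
    case (Suc n)
    have "u z \<le> C / 2 ^ n / 2 * exp (\<sigma> * z)" by (rule assms(3)[OF _ Suc]) (use assms(1) in simp)
    then show ?case by (simp add: field_simps)
  qed (use assms(2) in simp)
  moreover have "(\<lambda>n. C / 2 ^ n * exp (\<sigma> * z)) \<longlonglongrightarrow> 0" by real_asymp
  ultimately show ?thesis by (intro LIMSEQ_le_const[of _ 0 "u z"]) auto
qed

text \<open>Both bounds rest on \<open>2 * (2 + B) / \<alpha> \<le> 1\<close>. They let an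
  exponential bound pass through \<open>N\<close> at the cost of a factor
  \<open>2 * exp 1\<close>.\<close>

lemma N_upper:
  assumes "profile g" shows "N g z \<le> 2 * g (z + 1)" "1 - N g z \<le> 2 * (1 - g (z - 1))"
proof -
  note g = profileD[OF assms]
  have B: "2 / \<alpha> * (2 + B) \<le> 1" using alpha_large alpha_pos by (simp add: field_simps)
  have m: "g (z - 1) \<le> g z" "g z \<le> g (z + 1)" by (auto intro: g(2))
  have "f (g z) \<le> B * g z" using f_lipschitz[of "g z" 0] g(3)[of z] by simp
  also have "\<dots> \<le> B * g (z + 1)" using m B_nonneg by (simp add: mult_left_mono)
  finally have "g (z + 1) + g (z - 1) - 2 * g z + f (g z) \<le> (2 + B) * g (z + 1)"
    using m g(3)[of z] by (simp add: algebra_simps)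
  then have "2 / \<alpha> * (g (z + 1) + g (z - 1) - 2 * g z + f (g z)) \<le> 2 / \<alpha> * ((2 + B) * g (z + 1))"
    using alpha_pos by (intro mult_left_mono) auto
  also have "\<dots> \<le> g (z + 1)" using mult_right_mono[OF B, of "g (z + 1)"] g(3) by (simp add: mult_ac)
  finally show "N g z \<le> 2 * g (z + 1)" using m by (simp add: N_def)
  have "- f (g z) \<le> B * (1 - g z)" using f_lipschitz[of "g z" 1] g(4)[of z] by simp
  also have "\<dots> \<le> B * (1 - g (z - 1))" using m B_nonneg by (simp add: mult_left_mono)
  finally have "- (g (z + 1) + g (z - 1) - 2 * g z + f (g z)) \<le> (2 + B) * (1 - g (z - 1))"
    using m g(4)[of z] g(4)[of "z + 1"] by (simp add: algebra_simps)
  then have "2 / \<alpha> * (- (g (z + 1) + g (z - 1) - 2 * g z + f (g z))) \<le> 2 / \<alpha> * ((2 + B) * (1 - g (z - 1)))"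
    using alpha_pos by (intro mult_left_mono) auto
  also have "\<dots> \<le> 1 - g (z - 1)"
    using mult_right_mono[OF B, of "1 - g (z - 1)"] g(4)[of "z - 1"] by (simp only: mult.assoc) simp
  finally have le: "2 / \<alpha> * (- (g (z + 1) + g (z - 1) - 2 * g z + f (g z))) \<le> 1 - g (z - 1)" .
  have "1 - N g z = 1 - g z + 2 / \<alpha> * (- (g (z + 1) + g (z - 1) - 2 * g z + f (g z)))"
    unfolding N_def mult_minus_right by simp
  also have "\<dots> \<le> 1 - g z + (1 - g (z - 1))" using le by (rule add_left_mono)
  also have "\<dots> \<le> 2 * (1 - g (z - 1))" using m(1) by simp
  finally show "1 - N g z \<le> 2 * (1 - g (z - 1))" .
qed

text \<open>With \<open>exp 1 \<le> 3\<close>, two averages of weight below 1/4 outweigh the cost of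
  \<open>N\<close>: \<open>2 * 3 / 16 \<le> 1 / 2\<close>.\<close>

lemma weight_contract:
  assumes "weight k < 1 / 4" "0 \<le> A"
  shows "2 * exp 1 * A * weight k * weight k * exp y \<le> A / 2 * exp y"
proof -
  have *: "weight k * weight k \<le> 1 / 4 * (1 / 4)"
    by (rule mult_mono) (use assms weight_nonneg[of k] in auto)
  have "exp 1 * (weight k * weight k) \<le> 3 * (1 / 4 * (1 / 4))"
    by (rule mult_mono) (use * exp_le weight_nonneg[of k] in auto)
  then have "(2 * A) * (exp 1 * (weight k * weight k)) \<le> (2 * A) * (1 / 4)"
    using assms(2) by (intro mult_left_mono) auto
  from mult_right_mono[OF this, of "exp y"] show ?thesis by (simp add: mult_ac)
qed

text \<open>At a large speed, one application of \<open>T\<close> halves any bound of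
  \<open>g\<close> by a multiple of \<open>exp z\<close>. The subsolution starts with such a bound
  because it vanishes left of \<open>p\<close>, so it would vanish identically and could not tend to
  1.\<close>

lemma not_sub_speed: "\<exists>c. \<not> sub_speed c"
proof -
  obtain k where k: "0 < k" "weight k < 1 / 4" by (rule weight_small[of "1/4"]) auto
  have False if sp: "sub_speed k"
  proof -
    obtain p g where front: "front k (ereal p) \<infinity> g" using sp by (auto simp: sub_speed_def)
    then have "trunc_sol k (ereal p) \<infinity> g" by (simp add: front_def)
    note g = trunc_solD[OF this]
    have gT: "g z \<le> T k g z" for z
      using g(3,5)[of z] profileD(3)[OF T_profile[OF g(1)]] by (cases "z < p") auto
    have "g z \<le> 0" for z
    proof (rule exp_halving[where u = g and C = "exp (- p)" and \<sigma> = 1])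
      show "0 \<le> exp (- p)" by simp
      fix z show "g z \<le> exp (- p) * exp (1 * z)"
      proof (cases "z < p")
        case False
        then have "1 \<le> exp (- p) * exp (1 * z)" by (simp add: exp_add[symmetric])
        then show ?thesis using profileD(4)[OF g(1), of z] by simp
      qed (use g(3)[of z] in simp)
    next
      fix A z assume A: "0 \<le> A" and le: "\<And>y. g y \<le> A * exp (1 * y)"
      have "N g y \<le> 2 * exp 1 * A * exp (1 * y)" for y
        using N_upper(1)[OF g(1), of y] le[of "y + 1"] by (simp add: exp_add mult_ac)
      then have "S k (N g) y \<le> 2 * exp 1 * A * weight k * exp (1 * y)" for y
        unfolding S_def
        using A k profileD(3,4)[OF N_profile[OF g(1)]] profile_measurable[OF N_profile[OF g(1)]]
        by (intro S_exp_bound[where g = "N g"]) auto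
      then have "S k (S k (N g)) z \<le> 2 * exp 1 * A * weight k * weight k * exp (1 * z)"
        unfolding S_def[of k "S k (N g)"]
        using A k profileD(3,4)[OF S_profile[OF N_profile[OF g(1)]]] weight_nonneg[of k]
          profile_measurable[OF S_profile[OF N_profile[OF g(1)]]]
        by (intro S_exp_bound[where g = "S k (N g)"]) auto
      also have "\<dots> \<le> A / 2 * exp (1 * z)" by (rule weight_contract[OF k(2) A])
      finally show "g z \<le> A / 2 * exp (1 * z)" using gT[of z] by (simp add: T_def)
    qed
    then have "(g \<longlongrightarrow> 1) at_top \<Longrightarrow> (1::real) \<le> 0" by (intro tendsto_upperbound[of g]) auto
    then show False using front by (simp add: front_def)
  qed
  then show ?thesis by blast
qed

lemma one_minus_S: assumes "profile g" shows "1 - S c g z = (\<integral>s. 1 - g (z - c * s) \<partial>E)"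
  using assms by (simp add: S_def E.prob_space[simplified])

text \<open>The mirror argument at a very negative speed: \<open>1 - g\<close> vanishes from
  \<open>q\<close> on and is bounded by shrinking multiples of \<open>exp (- z)\<close>.\<close>

lemma not_super_speed: "\<exists>c. \<not> super_speed c"
proof -
  obtain k where k: "0 < k" "weight k < 1 / 4" by (rule weight_small[of "1/4"]) auto
  have False if sp: "super_speed (- k)"
  proof -
    obtain q g where front: "front (- k) (-\<infinity>) (ereal q) g" using sp by (auto simp: super_speed_def)
    then have "trunc_sol (- k) (-\<infinity>) (ereal q) g" by (simp add: front_def)
    note g = trunc_solD[OF this]
    have gT: "T (- k) g z \<le> g z" for z
      using g(4,5)[of z] profileD(4)[OF T_profile[OF g(1)]] by (cases "z < q") auto
    have "1 - g z \<le> 0" for z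
    proof (rule exp_halving[where u = "\<lambda>z. 1 - g z" and C = "exp q" and \<sigma> = "-1"])
      show "0 \<le> exp q" by simp
      fix z show "1 - g z \<le> exp q * exp (- 1 * z)"
      proof (cases "z < q")
        case True
        then have "1 \<le> exp q * exp (- 1 * z)" by (simp add: exp_add[symmetric])
        then show ?thesis using profileD(3)[OF g(1), of z] by simp
      qed (use g(4)[of z] in simp)
    next
      fix A z assume A: "0 \<le> A" and le: "\<And>y. 1 - g y \<le> A * exp (- 1 * y)"
      have "1 - N g y \<le> 2 * exp 1 * A * exp (- 1 * y)" for y
      proof -
        have *: "1 - g (y - 1) \<le> A * (exp 1 * exp (- 1 * y))"
          using le[of "y - 1"] by (simp add: exp_add[symmetric])
        from N_upper(2)[OF g(1), of y] have "1 - N g y \<le> 2 * (1 - g (y - 1))" .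
        also have "\<dots> \<le> 2 * (A * (exp 1 * exp (- 1 * y)))" using * by simp
        finally show ?thesis by (simp add: mult_ac)
      qed
      then have "1 - S (- k) (N g) y \<le> 2 * exp 1 * A * weight k * exp (- 1 * y)" for y
        unfolding one_minus_S[OF N_profile[OF g(1)]]
        using A k profileD(3,4)[OF N_profile[OF g(1)]] profile_measurable[OF N_profile[OF g(1)]]
        by (intro S_exp_bound[where g = "\<lambda>y. 1 - N g y"]) auto
      then have "1 - S (- k) (S (- k) (N g)) z \<le> 2 * exp 1 * A * weight k * weight k * exp (- 1 * z)"
        unfolding one_minus_S[OF S_profile[OF N_profile[OF g(1)]]]
        using A k profileD(3,4)[OF S_profile[OF N_profile[OF g(1)]]] weight_nonneg[of k]
          profile_measurable[OF S_profile[OF N_profile[OF g(1)]]]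
        by (intro S_exp_bound[where g = "\<lambda>y. 1 - S (- k) (N g) y"]) auto
      also have "\<dots> \<le> A / 2 * exp (- 1 * z)" by (rule weight_contract[OF k(2) A])
      finally show "1 - g z \<le> A / 2 * exp (- 1 * z)" using gT[of z] by (simp add: T_def)
    qed
    then have "1 \<le> g z" for z by (simp add: algebra_simps)
    then have "(g \<longlongrightarrow> 0) at_bot \<Longrightarrow> (1::real) \<le> 0" by (intro tendsto_lowerbound[of g]) auto
    then show False using front by (simp add: front_def)
  qed
  then show ?thesis by blast
qed

theorem wave_exists: "\<exists>c g. profile g \<and> g = T c g \<and> (g \<longlongrightarrow> 0) at_bot \<and> (g \<longlongrightarrow> 1) at_top"
proof -
  have "\<exists>c. wave_speed c"
  proof (rule ccontr)
    assume no: "\<not> ?thesis"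
    have "closed {c. sub_speed c}" "closed {c. super_speed c}"
      unfolding closed_sequential_limits using sub_speed_closed super_speed_closed no by blast+
    moreover have "{c. sub_speed c} \<inter> {c. super_speed c} = {}" using sub_super_wave no by blast
    moreover have "UNIV \<subseteq> {c. sub_speed c} \<union> {c. super_speed c}" using speed_trichotomy no by blast
    \<comment> \<open>Each set misses some speed, and that speed must lie in the other set.\<close>
    moreover have "{c. sub_speed c} \<noteq> {}" "{c. super_speed c} \<noteq> {}"
      using not_sub_speed not_super_speed speed_trichotomy no by blast+
    ultimately have "\<not> connected (UNIV :: real set)" unfolding connected_closed by (simp, blast)
    then show False by simp
  qed
  then obtain c g where "front c (-\<infinity>) \<infinity> g" by (auto simp: wave_speed_def)
  then have "trunc_sol c (-\<infinity>) \<infinity> g" "(g \<longlongrightarrow> 0) at_bot" "(g \<longlongrightarrow> 1) at_top" by (auto simp: front_def)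
  moreover from this(1) have "profile g" "g = T c g"
    by (auto simp: trunc_sol_def trunc_inf fun_eq_iff)
  ultimately show ?thesis by blast
qed

end

subsection \<open>Uniqueness of waves\<close>

context exponential_average
begin

lemma S_isCont: assumes "profile g" "\<And>z. isCont g z" shows "isCont (S c g) z"
proof (cases "c = 0")
  case True
  then have "S c g = g" by (simp add: fun_eq_iff)
  then show ?thesis using assms(2) by simp
qed (use S_continuous assms(1) in blast)

lemma S_eq_FTC:
  assumes g: "profile g" "\<And>z. isCont g z"
    and F: "\<And>s. 0 \<le> s \<Longrightarrow> (F has_real_derivative \<alpha> * exp (- \<alpha> * s) * g (z - c * s)) (at s)"
    and L: "(F \<longlongrightarrow> L) at_top"
  shows "S c g z = L - F 0"
proof -
  have [measurable]: "g \<in> borel_measurable borel" by (rule profile_measurable[OF g(1)])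
  have nn: "(\<integral>\<^sup>+ s. ennreal (\<alpha> * exp (- \<alpha> * s) * g (z - c * s)) * indicator {0..} s \<partial>lborel) = ennreal (L - F 0)"
    by (rule nn_integral_FTC_atLeast) (use F L alpha_pos profileD(3)[OF g(1)] in auto)
  have F0: "F 0 \<le> L"
  proof (rule tendsto_lowerbound[OF L])
    have "F 0 \<le> F s" if "0 \<le> s" for s
    proof (rule DERIV_nonneg_imp_nondecreasing[OF that])
      fix x :: real assume "0 \<le> x"
      then show "\<exists>y. (F has_real_derivative y) (at x) \<and> 0 \<le> y"
        using F[of x] alpha_pos profileD(3)[OF g(1), of "z - c * x"]
        by (intro exI[of _ "\<alpha> * exp (- \<alpha> * x) * g (z - c * x)"] conjI) auto
    qed
    then show "\<forall>\<^sub>F s in at_top. F 0 \<le> F s" by (auto simp: eventually_at_top_linorder)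
  qed simp
  have "S c g z = (\<integral>s. exponential_density \<alpha> s * g (z - c * s) \<partial>lborel)"
    unfolding S_def by (subst integral_real_density) (use alpha_pos in \<open>auto simp: exponential_density_def\<close>)
  also have "\<dots> = enn2real (\<integral>\<^sup>+ s. ennreal (exponential_density \<alpha> s * g (z - c * s)) \<partial>lborel)"
    by (rule integral_eq_nn_integral)
      (use alpha_pos profileD(3)[OF g(1)] in \<open>auto simp: exponential_density_def\<close>)
  also have "(\<integral>\<^sup>+ s. ennreal (exponential_density \<alpha> s * g (z - c * s)) \<partial>lborel)
    = (\<integral>\<^sup>+ s. ennreal (\<alpha> * exp (- \<alpha> * s) * g (z - c * s)) * indicator {0..} s \<partial>lborel)"
    by (intro nn_integral_cong) (auto simp: exponential_density_def mult.commute split: split_indicator)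
  finally show ?thesis unfolding nn using F0 by simp
qed

text \<open>The antiderivative \<open>- exp (- \<alpha> * s) * h (z - c * s)\<close> evaluates the
  average. Boundedness of \<open>h\<close> kills the boundary term at infinity and so excludes the
  homogeneous solutions, multiples of \<open>exp (- \<alpha> * z / c)\<close>.\<close>

lemma S_unique:
  assumes g: "profile g" "\<And>z. isCont g z" and c: "c \<noteq> 0" and h: "\<And>z. 0 \<le> h z" "\<And>z. h z \<le> 1"
    and der: "\<And>z. (h has_real_derivative \<alpha> / c * (g z - h z)) (at z)"
  shows "h z = S c g z"
proof -
  have "S c g z = 0 - (- exp (- \<alpha> * 0) * h (z - c * 0))"
  proof (rule S_eq_FTC[OF g])
    fix s :: real
    show "((\<lambda>s. - exp (- \<alpha> * s) * h (z - c * s)) has_real_derivative \<alpha> * exp (- \<alpha> * s) * g (z - c * s)) (at s)"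
      by (rule derivative_eq_intros DERIV_chain2[OF der] refl)+ (use c in \<open>simp add: field_simps\<close>)
    show "((\<lambda>s. - exp (- \<alpha> * s) * h (z - c * s)) \<longlongrightarrow> 0) at_top"
    proof (rule Lim_null_comparison)
      show "\<forall>\<^sub>F s in at_top. norm (- exp (- \<alpha> * s) * h (z - c * s)) \<le> exp (- \<alpha> * s)"
        using h by (intro always_eventually allI) (simp add: abs_mult mult_left_le)
      show "((\<lambda>s. exp (- \<alpha> * s)) \<longlongrightarrow> 0) at_top" using alpha_pos by real_asymp
    qed
  qed
  then show ?thesis by simp
qed

text \<open>Variation of constants: with an antiderivative \<open>G\<close> of the source times the
  integrating factor, the average becomes \<open>exp (- \<alpha> * w / c) * (l + G w)\<close>, which
  can be differentiated directly.\<close>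

lemma S_deriv:
  assumes g: "profile g" "\<And>z. isCont g z" and c: "c \<noteq> 0"
  shows "(S c g has_real_derivative \<alpha> / c * (g z - S c g z)) (at z)"
proof -
  define k where "k y = \<alpha> / c * exp (\<alpha> * y / c) * g y" for y
  define G where "G u = (LBINT y=0..ereal u. k y)" for u
  have k_cont: "isCont k y" for y unfolding k_def using c by (intro continuous_intros g)
  have G: "(G has_real_derivative k x) (at x)" for x
  proof -
    \<comment> \<open>The interval is taken large enough to contain the base point 0 and to have
      \<open>x\<close> in its interior.\<close>
    have "(G has_vector_derivative k x) (at x within {- \<bar>x\<bar> - 1..\<bar>x\<bar> + 1})"
      unfolding G_def zero_ereal_def
      by (rule interval_integral_FTC2) (auto intro!: continuous_at_imp_continuous_on k_cont)
    moreover have "at x within {- \<bar>x\<bar> - 1..\<bar>x\<bar> + 1} = at x" by (rule at_within_interior) auto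
    ultimately show ?thesis by (simp add: has_real_derivative_iff_has_vector_derivative)
  qed
  have G0: "G 0 = 0" by (simp add: G_def zero_ereal_def)
  \<comment> \<open>These are the partial integrals of \<open>S c g 0\<close>. They are monotone and
    bounded for either sign of \<open>c\<close>, and their limit is the constant of integration
    \<open>l\<close>.\<close>
  define M where "M s = - G (- (c * s))" for s
  have M: "(M has_real_derivative \<alpha> * exp (- \<alpha> * s) * g (- (c * s))) (at s)" for s
    unfolding M_def
    by (rule derivative_eq_intros DERIV_chain2[OF G] refl)+ (use c in \<open>simp add: k_def field_simps\<close>)
  have M_mono: "M s \<le> M t" if "s \<le> t" for s t
  proof (rule DERIV_nonneg_imp_nondecreasing[OF that])
    fix x
    show "\<exists>y. (M has_real_derivative y) (at x) \<and> 0 \<le> y"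
      using M[of x] alpha_pos profileD(3)[OF g(1), of "- (c * x)"]
      by (intro exI[of _ "\<alpha> * exp (- \<alpha> * x) * g (- (c * x))"] conjI) auto
  qed
  have M_bd: "M s + exp (- \<alpha> * s) \<le> M 0 + exp (- \<alpha> * 0)" if "0 \<le> s" for s
  proof (rule DERIV_nonpos_imp_nonincreasing[OF that])
    fix x
    have "((\<lambda>s. M s + exp (- \<alpha> * s)) has_real_derivative \<alpha> * exp (- \<alpha> * x) * g (- (c * x)) - \<alpha> * exp (- \<alpha> * x)) (at x)"
      by (rule derivative_eq_intros M refl)+ simp
    moreover have "\<alpha> * exp (- \<alpha> * x) * g (- (c * x)) \<le> \<alpha> * exp (- \<alpha> * x)"
      using alpha_pos profileD(3,4)[OF g(1)] by (simp add: mult_left_le)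
    ultimately show "\<exists>y. ((\<lambda>s. M s + exp (- \<alpha> * s)) has_real_derivative y) (at x) \<and> y \<le> 0"
      by (intro exI conjI) (assumption, simp)
  qed
  have M0: "M 0 = 0" by (simp add: M_def G0)
  have "M s \<le> 1" if "0 \<le> s" for s
  proof -
    have "M s + exp (- \<alpha> * s) \<le> 1" using M_bd[OF that] M0 by simp
    then show ?thesis using exp_gt_zero[of "- \<alpha> * s"] by linarith
  qed
  moreover have "0 \<le> M s" if "0 \<le> s" for s using M_mono[OF that] M0 by simp
  \<comment> \<open>Only \<open>s \<ge> 0\<close> matters for the limit; freezing \<open>M\<close>
    at 0 for negative arguments gives a profile, whose limit is known to exist.\<close>
  ultimately have "profile (\<lambda>s. M (max s 0))"
    by (intro profileI monoI M_mono) auto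
  then obtain l where l: "((\<lambda>s. M (max s 0)) \<longlongrightarrow> l) at_top" using profile_lim_at_top by blast
  have "\<forall>\<^sub>F s in at_top. M (max s 0) = M s" using eventually_ge_at_top[of 0] by eventually_elim simp
  from Lim_transform_eventually[OF l this] have Ml: "(M \<longlongrightarrow> l) at_top" .
  have S_eq: "S c g w = exp (- \<alpha> * w / c) * (l + G w)" for w
  proof -
    have "S c g w = exp (- \<alpha> * w / c) * l - exp (- \<alpha> * w / c) * - G (w - c * 0)"
    proof (rule S_eq_FTC[OF g])
      fix s :: real
      have e: "exp (- \<alpha> * w / c) * exp (\<alpha> * (w - c * s) / c) = exp (- \<alpha> * s)"
        using c by (simp add: exp_add[symmetric] field_simps)
      have "((\<lambda>s. exp (- \<alpha> * w / c) * - G (w - c * s)) has_real_derivative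
          exp (- \<alpha> * w / c) * (c * k (w - c * s))) (at s)"
        by (rule derivative_eq_intros DERIV_chain2[OF G] refl)+ simp
      also have "exp (- \<alpha> * w / c) * (c * k (w - c * s)) =
          \<alpha> * (exp (- \<alpha> * w / c) * exp (\<alpha> * (w - c * s) / c)) * g (w - c * s)"
        using c by (simp add: k_def)
      finally show "((\<lambda>s. exp (- \<alpha> * w / c) * - G (w - c * s)) has_real_derivative
          \<alpha> * exp (- \<alpha> * s) * g (w - c * s)) (at s)" unfolding e .
      have "filterlim (\<lambda>s. - w / c + s) at_top at_top"
        by (rule filterlim_tendsto_add_at_top[OF tendsto_const filterlim_ident])
      from filterlim_compose[OF Ml this] have "((\<lambda>s. M (- w / c + s)) \<longlongrightarrow> l) at_top" .
      moreover have "M (- w / c + s) = - G (w - c * s)" for s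
      proof -
        have "- (c * (- w / c + s)) = w - c * s" using c by (simp add: field_simps)
        then show ?thesis by (simp only: M_def)
      qed
      ultimately have "((\<lambda>s. - G (w - c * s)) \<longlongrightarrow> l) at_top" by simp
      then show "((\<lambda>s. exp (- \<alpha> * w / c) * - G (w - c * s)) \<longlongrightarrow> exp (- \<alpha> * w / c) * l) at_top"
        by (intro tendsto_mult tendsto_const)
    qed
    then show ?thesis by (simp add: algebra_simps)
  qed
  have "((\<lambda>w. exp (- \<alpha> * w / c)) has_real_derivative - \<alpha> / c * exp (- \<alpha> * z / c)) (at z)"
    by (rule derivative_eq_intros refl | use c in simp)+
  from DERIV_mult[OF this DERIV_add[OF DERIV_const G]]
  have "((\<lambda>w. exp (- \<alpha> * w / c) * (l + G w)) has_real_derivative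
      - \<alpha> / c * (exp (- \<alpha> * z / c) * (l + G z)) + exp (- \<alpha> * z / c) * k z) (at z)"
    by (simp add: mult_ac)
  moreover have "exp (- \<alpha> * z / c) * exp (\<alpha> * z / c) = 1" using c by (simp add: exp_add[symmetric] field_simps)
  then have "exp (- \<alpha> * z / c) * k z = \<alpha> / c * g z"
    by (simp add: k_def)
  moreover have "S c g = (\<lambda>w. exp (- \<alpha> * w / c) * (l + G w))" using S_eq by auto
  ultimately show ?thesis by (simp add: algebra_simps)
qed

end

section \<open>Comparison, sliding and uniqueness\<close>

context bistable_chain
begin

text \<open>Let \<open>m > 0\<close> be the supremum of \<open>g - h\<close>. Where
  \<open>g > h\<close>, both values lie in a zone in which \<open>f\<close> decreases at rate \<mu>;
  elsewhere only the neighbours contribute. Either way the operator shrinks the excess, giving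
  \<open>m \<le> \<rho> * m\<close> with \<open>\<rho> < 1\<close>.\<close>

lemma comparison_contraction:
  assumes g: "profile g" "\<And>z. g z \<le> T c g z" and h: "profile h" "\<And>z. T c h z \<le> h z"
    and zone: "\<And>z. g z \<le> h z \<or> (g z \<le> \<delta> \<and> h z \<le> \<delta>) \<or> (1 - \<delta> \<le> g z \<and> 1 - \<delta> \<le> h z)"
  shows "g z \<le> h z"
proof (rule ccontr)
  assume not: "\<not> g z \<le> h z"
  define m where "m = (SUP z. g z - h z)"
  have bdd: "bdd_above (range (\<lambda>z. g z - h z))"
  proof (rule bdd_aboveI2)
    show "g z - h z \<le> 1" for z using profileD(4)[OF g(1), of z] profileD(3)[OF h(1), of z] by simp
  qed
  have w: "g y - h y \<le> m" for y unfolding m_def by (rule cSUP_upper[OF _ bdd]) simp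
  have m: "0 < m" using w[of z] not by simp
  \<comment> \<open>The first entry is the factor where \<open>g > h\<close>, the second the
    neighbour contribution where \<open>g \<le> h\<close>. The maximum also makes
    \<open>\<rho> - 4 / \<alpha>\<close> nonnegative, so \<open>g - h\<close> can be replaced by
    \<open>m\<close>.\<close>
  define \<rho> where "\<rho> = max (1 - 2 * \<mu> / \<alpha>) (4 / \<alpha>)"
  have rho: "\<rho> < 1" using mu_pos alpha_pos alpha_large B_nonneg by (simp add: \<rho>_def)
  have a0: "0 < 2 / \<alpha>" using alpha_pos by simp
  have N: "N g y \<le> N h y + \<rho> * m" for y
  proof -
    let ?s = "g (y + 1) - h (y + 1) + (g (y - 1) - h (y - 1))"
    have "2 / \<alpha> * ?s \<le> 2 / \<alpha> * (2 * m)"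
      using a0 w[of "y + 1"] w[of "y - 1"] by (intro mult_left_mono) auto
    then have s: "2 / \<alpha> * ?s \<le> 4 / \<alpha> * m" by simp
    show ?thesis
    proof (cases "g y \<le> h y")
      case True
      have "N g y - N h y \<le> 2 / \<alpha> * ?s"
      proof -
        have "0 \<le> \<kappa> * (h y - g y)" using kappa_pos True by simp
        moreover have "2 / \<alpha> * ?s = - (2 / \<alpha> * (h (y + 1) - g (y + 1) + (h (y - 1) - g (y - 1))))"
          by (simp add: algebra_simps)
        ultimately show ?thesis using N_diff[of g y h, OF True] by linarith
      qed
      also have "\<dots> \<le> 4 / \<alpha> * m" by (rule s)
      also have "\<dots> \<le> \<rho> * m" using m by (intro mult_right_mono) (auto simp: \<rho>_def)
      finally show ?thesis by simp
    next
      case False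
      then have "f (g y) - f (h y) \<le> - \<mu> * (g y - h y)"
        using zone[of y] profileD(3)[OF h(1), of y] profileD(4)[OF g(1), of y]
          f_stable_0[of "h y" "g y"] f_stable_1[of "h y" "g y"] by auto
      then have "2 / \<alpha> * (f (g y) - f (h y)) \<le> 2 / \<alpha> * (- \<mu> * (g y - h y))"
        using a0 by (intro mult_left_mono) auto
      moreover have "N g y - N h y = (1 - 4 / \<alpha>) * (g y - h y) + 2 / \<alpha> * (f (g y) - f (h y)) + 2 / \<alpha> * ?s"
        by (simp add: N_def algebra_simps diff_divide_distrib add_divide_distrib)
      ultimately have le: "N g y - N h y \<le> (1 - 4 / \<alpha> - 2 * \<mu> / \<alpha>) * (g y - h y) + 4 / \<alpha> * m"
        using s by (simp add: algebra_simps diff_divide_distrib add_divide_distrib)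
      have "(1 - 4 / \<alpha> - 2 * \<mu> / \<alpha>) * (g y - h y) \<le> (\<rho> - 4 / \<alpha>) * m"
      proof -
        have "(1 - 4 / \<alpha> - 2 * \<mu> / \<alpha>) * (g y - h y) \<le> (\<rho> - 4 / \<alpha>) * (g y - h y)"
          using False by (intro mult_right_mono) (auto simp: \<rho>_def)
        also have "\<dots> \<le> (\<rho> - 4 / \<alpha>) * m"
          using w by (intro mult_left_mono) (auto simp: \<rho>_def)
        finally show ?thesis .
      qed
      with le show ?thesis by (simp add: algebra_simps)
    qed
  qed
  have "S c (N g) y \<le> S c (N h) y + \<rho> * m" for y
    by (rule S_le_shift[OF N_profile[OF g(1)] N_profile[OF h(1)] N])
  then have T_le: "T c g y \<le> T c h y + \<rho> * m" for y
    unfolding T_def by (rule S_le_shift[OF S_profile[OF N_profile[OF g(1)]] S_profile[OF N_profile[OF h(1)]]])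
  have "g y - h y \<le> \<rho> * m" for y using T_le[of y] g(2)[of y] h(2)[of y] by simp
  then have "m \<le> \<rho> * m" unfolding m_def by (intro cSUP_least) auto
  moreover have "\<rho> * m < 1 * m" using rho m by (rule mult_strict_right_mono)
  ultimately show False by simp
qed

text \<open>Equality at a point spreads through both averages to the ray behind it, and through
  \<open>N\<close> to the two neighbours of each point of that ray. Integer steps followed by one
  ray reach every point.\<close>

lemma strong_maximum:
  assumes g: "profile g" "\<And>z. isCont g z" "\<And>z. g z \<le> T c g z"
    and h: "profile h" "\<And>z. isCont h z" "\<And>z. T c h z \<le> h z"
    and le: "\<And>z. g z \<le> h z" and touch: "g z0 = h z0" and c: "c \<noteq> 0"
  shows "g y = h y"
proof -
  note Ng = N_profile[OF g(1)] and Nh = N_profile[OF h(1)]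
  have N_le: "N g z \<le> N h z" for z by (rule N_mono[OF le le le])
  have step: "g (z - c * t) = h (z - c * t) \<and> g (z - c * t + 1) = h (z - c * t + 1)
      \<and> g (z - c * t - 1) = h (z - c * t - 1)" if z: "g z = h z" and t: "0 \<le> t" for z t
  proof -
    have "S c (S c (N h)) z \<le> S c (S c (N g)) z" using g(3)[of z] h(3)[of z] z by (simp add: T_def)
    from S_eq_imp_eq[OF S_profile[OF Ng] S_profile[OF Nh] S_continuous[OF Ng c] S_continuous[OF Nh c]
        S_mono[OF Ng Nh N_le] this order_refl]
    have "S c (N h) z \<le> S c (N g) z" by simp
    from S_eq_imp_eq[OF Ng Nh N_isCont[OF g(2)] N_isCont[OF h(2)] N_le this t]
    have eq: "N g (z - c * t) = N h (z - c * t)" .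
    let ?y = "z - c * t"
    have "\<kappa> * (h ?y - g ?y) + 2 / \<alpha> * (h (?y + 1) - g (?y + 1) + (h (?y - 1) - g (?y - 1))) \<le> 0"
      using N_diff[of g ?y h, OF le] eq by simp
    moreover have "0 \<le> \<kappa> * (h ?y - g ?y)" using kappa_pos le[of ?y] by simp
    moreover have "0 \<le> 2 / \<alpha> * (h (?y + 1) - g (?y + 1) + (h (?y - 1) - g (?y - 1)))"
      using alpha_pos le[of "?y + 1"] le[of "?y - 1"] by simp
    ultimately have "\<kappa> * (h ?y - g ?y) = 0" "2 / \<alpha> * (h (?y + 1) - g (?y + 1) + (h (?y - 1) - g (?y - 1))) = 0"
      by linarith+
    then have "h ?y = g ?y" "h (?y + 1) - g (?y + 1) + (h (?y - 1) - g (?y - 1)) = 0"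
      using kappa_pos alpha_pos by auto
    then show ?thesis using le[of "?y + 1"] le[of "?y - 1"] by simp
  qed
  have nat: "g (z0 + real n) = h (z0 + real n) \<and> g (z0 - real n) = h (z0 - real n)" for n
  proof (induction n)
    case 0 show ?case using touch by simp
  next
    case (Suc n)
    show ?case using step[of "z0 + real n" 0] step[of "z0 - real n" 0] Suc by (simp add: algebra_simps)
  qed
  obtain n :: nat where n: "\<bar>y - z0\<bar> \<le> real n" using real_arch_simple by blast
  \<comment> \<open>The integer translate lies far enough in the direction of \<open>c\<close> that
    the ray \<open>z - c * t\<close> passes through \<open>y\<close>.\<close>
  define z where "z = (if 0 < c then z0 + real n else z0 - real n)"
  define t where "t = (z - y) / c"
  have "g z = h z" using nat[of n] by (simp add: z_def)
  moreover have "0 \<le> t" using n c by (auto simp: t_def z_def divide_nonneg_pos divide_nonpos_neg)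
  ultimately have "g (z - c * t) = h (z - c * t)" using step by blast
  then show ?thesis using c by (simp add: t_def)
qed

text \<open>The shift makes \<open>h\<close> exceed \<open>1 - \<delta>\<close> wherever
  \<open>g\<close> is not yet known to be below \<delta>, so any violation of the order would lie in
  a stable zone.\<close>

lemma sub_le_shifted_super:
  assumes g: "profile g" "\<And>z. g z \<le> T c g z" "(g \<longlongrightarrow> 0) at_bot"
    and h: "profile h" "\<And>z. T c h z \<le> h z" "(h \<longlongrightarrow> 1) at_top"
  obtains s where "\<And>z. g z \<le> h (z + s)"
proof -
  from order_tendstoD(2)[OF g(3) delta_pos] obtain z1 where z1: "\<And>z. z \<le> z1 \<Longrightarrow> g z < \<delta>"
    by (auto simp: eventually_at_bot_linorder)
  have "1 - \<delta> < 1" using delta_pos by simp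
  from order_tendstoD(1)[OF h(3) this] obtain z2 where z2: "\<And>z. z2 \<le> z \<Longrightarrow> 1 - \<delta> < h z"
    by (auto simp: eventually_at_top_linorder)
  show ?thesis
  proof
    fix z
    show "g z \<le> h (z + (z2 - z1))"
    proof (rule comparison_contraction[OF g(1,2) profile_shift[OF h(1)]])
      show "T c (\<lambda>z. h (z + (z2 - z1))) z \<le> h (z + (z2 - z1))" for z unfolding T_shift by (rule h(2))
      fix z
      show "g z \<le> h (z + (z2 - z1)) \<or> (g z \<le> \<delta> \<and> h (z + (z2 - z1)) \<le> \<delta>) \<or>
          (1 - \<delta> \<le> g z \<and> 1 - \<delta> \<le> h (z + (z2 - z1)))"
        using z1[of z] z2[of "z + (z2 - z1)"] by (cases "z \<le> z1") auto
    qed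
  qed
qed

text \<open>Take the least shift that keeps \<open>h\<close> above \<open>g\<close>. Without contact
  a compactness argument would permit a smaller shift, and contact forces equality by the strong
  maximum principle.\<close>

lemma sliding:
  assumes g: "profile g" "\<And>z. isCont g z" "\<And>z. g z \<le> T c g z" "(g \<longlongrightarrow> 0) at_bot" "(g \<longlongrightarrow> 1) at_top"
    and h: "profile h" "\<And>z. isCont h z" "\<And>z. T c h z \<le> h z" "(h \<longlongrightarrow> 0) at_bot" "(h \<longlongrightarrow> 1) at_top"
    and c: "c \<noteq> 0"
  obtains s where "\<And>z. g z = h (z + s)"
proof -
  define A where "A = {s. \<forall>z. g z \<le> h (z + s)}"
  have "A \<noteq> {}" using sub_le_shifted_super[OF g(1,3,4) h(1,3,5)] by (auto simp: A_def)
  have bdd: "bdd_below A"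
  proof -
    from order_tendstoD(1)[OF g(5), of "1/2"] obtain z0 where z0: "1 / 2 < g z0"
      by (auto simp: eventually_at_top_linorder)
    from order_tendstoD(2)[OF h(4), of "1/2"] obtain y0 where y0: "\<And>y. y \<le> y0 \<Longrightarrow> h y < 1 / 2"
      by (auto simp: eventually_at_bot_linorder)
    have "y0 - z0 \<le> s" if "s \<in> A" for s
    proof (rule ccontr)
      assume "\<not> y0 - z0 \<le> s"
      then have "h (z0 + s) < 1 / 2" by (intro y0) simp
      moreover have "g z0 \<le> h (z0 + s)" using that by (simp add: A_def)
      ultimately show False using z0 by simp
    qed
    then show ?thesis by (rule bdd_belowI)
  qed
  define s where "s = Inf A"
  have above: "g z \<le> h (z + t)" if st: "s < t" for z t
  proof -
    from cInf_less_iff[OF \<open>A \<noteq> {}\<close> bdd, of t] st obtain r where r: "r \<in> A" "r < t"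
      unfolding s_def by (elim iffE impE) (assumption, auto)
    have "g z \<le> h (z + r)" using r(1) by (simp add: A_def)
    also have "\<dots> \<le> h (z + t)" using r(2) by (intro profileD(2)[OF h(1)]) simp
    finally show ?thesis .
  qed
  have le: "g z \<le> h (z + s)" for z
  proof (rule LIMSEQ_le_const)
    have "(\<lambda>n. z + (s + 1 / real (Suc n))) \<longlonglongrightarrow> z + (s + 0)"
      by (intro tendsto_add tendsto_const) real_asymp
    from isCont_tendsto_compose[OF h(2) this]
    show "(\<lambda>n. h (z + (s + 1 / real (Suc n)))) \<longlonglongrightarrow> h (z + s)" by simp
    show "\<exists>N. \<forall>n\<ge>N. g z \<le> h (z + (s + 1 / real (Suc n)))"
      by (intro exI[of _ 0] allI impI above) simp
  qed
  have "\<exists>z0. g z0 = h (z0 + s)"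
  proof (rule ccontr)
    assume "\<not> ?thesis"
    then have lt: "g z < h (z + s)" for z using le[of z] by (metis order_le_less)
    from order_tendstoD(2)[OF g(4) delta_pos] obtain z1 where z1: "\<And>z. z \<le> z1 \<Longrightarrow> g z < \<delta>"
      by (auto simp: eventually_at_bot_linorder)
    have "1 - \<delta> < 1" using delta_pos by simp
    from order_tendstoD(1)[OF h(5) this] obtain y2 where y2: "\<And>y. y2 \<le> y \<Longrightarrow> 1 - \<delta> < h y"
      by (auto simp: eventually_at_top_linorder)
    \<comment> \<open>The extra 1 leaves room for sliding by \<open>t < 1\<close>: right of
      \<open>z2\<close> the function \<open>h\<close> still exceeds \<open>1 - \<delta>\<close>
      after the slide.\<close>
    define z2 where "z2 = max z1 (y2 - s + 1)"
    have z12: "z1 \<le> z2" "y2 \<le> z2 + s - 1" by (auto simp: z2_def)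
    have cont: "continuous_on X h" "continuous_on X g" for X
      using g(2) h(2) by (auto intro: continuous_at_imp_continuous_on)
    have cont': "continuous_on {z1..z2} (\<lambda>z. h (z + s) - g z)"
      by (intro continuous_intros continuous_on_compose2[OF cont(1)[of UNIV]] cont) auto
    have "{z1..z2} \<noteq> {}" using z12 by simp
    from continuous_attains_inf[OF compact_Icc this cont'] obtain x
      where x: "x \<in> {z1..z2}" "\<And>z. z \<in> {z1..z2} \<Longrightarrow> h (x + s) - g x \<le> h (z + s) - g z" by blast
    define e where "e = h (x + s) - g x"
    have e: "0 < e" using lt by (simp add: e_def)
    have "uniformly_continuous_on {z1 + s - 1..z2 + s} h"
      by (rule compact_uniformly_continuous[OF cont(1)]) simp
    then obtain d where d: "0 < d"
      "\<And>u v. u \<in> {z1 + s - 1..z2 + s} \<Longrightarrow> v \<in> {z1 + s - 1..z2 + s} \<Longrightarrow> dist u v < d \<Longrightarrow> dist (h u) (h v) < e"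
      unfolding uniformly_continuous_on_def using e by blast
    define t where "t = min (d / 2) (1 / 2)"
    have t: "0 < t" "t < d" "t < 1" using d(1) by (auto simp: t_def)
    \<comment> \<open>On the compact middle part the gap is at least \<open>e\<close> and uniform
      continuity preserves the order; outside it, any violation lies in a stable zone and the
      contraction applies.\<close>
    have "g z \<le> h (z + (s - t))" for z
    proof (rule comparison_contraction[OF g(1,3) profile_shift[OF h(1)]])
      show "T c (\<lambda>z. h (z + (s - t))) z \<le> h (z + (s - t))" for z unfolding T_shift by (rule h(3))
      fix z
      consider "z \<le> z1" | "z1 \<le> z" "z \<le> z2" | "z2 \<le> z" by linarith
      then show "g z \<le> h (z + (s - t)) \<or> (g z \<le> \<delta> \<and> h (z + (s - t)) \<le> \<delta>) \<or>
          (1 - \<delta> \<le> g z \<and> 1 - \<delta> \<le> h (z + (s - t)))"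
      proof cases
        case 1 then show ?thesis using z1[of z] by auto
      next
        case 2
        then have "dist (h (z + (s - t))) (h (z + s)) < e"
          by (intro d(2)) (use t in \<open>auto simp: dist_real_def\<close>)
        moreover have "e \<le> h (z + s) - g z" using x(2)[of z] 2 by (simp add: e_def)
        ultimately have "g z \<le> h (z + (s - t))" unfolding dist_real_def by linarith
        then show ?thesis ..
      next
        case 3
        then have "1 - \<delta> < h (z + (s - t))" using z12 t by (intro y2) simp
        then show ?thesis by linarith
      qed
    qed
    then have "s - t \<in> A" by (simp add: A_def)
    then have "s \<le> s - t" unfolding s_def by (intro cInf_lower bdd)
    then show False using t by simp
  qed
  then obtain z0 where z0: "g z0 = h (z0 + s)" by blast
  have "g z = h (z + s)" for z
  proof (rule strong_maximum[OF g(1,2,3) profile_shift[OF h(1)] _ _ _ z0 c])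
    show "isCont (\<lambda>z. h (z + s)) z" for z
      by (rule isCont_o2[OF _ h(2)]) simp
    show "T c (\<lambda>z. h (z + s)) z \<le> h (z + s)" for z unfolding T_shift by (rule h(3))
  qed (rule le)
  then show ?thesis by (rule that)
qed

text \<open>Together with monotonicity in the speed, \<open>le\<close> is an equality. It passes
  through both averages and gives \<open>N g (z - d * t) = N g (z - c * t)\<close> for all
  \<open>t \<ge> 0\<close>; the two points can be arbitrarily far apart, which contradicts the
  limits 0 and 1.\<close>

lemma two_speeds_False:
  assumes g: "profile g" "\<And>z. isCont g z" "(g \<longlongrightarrow> 0) at_bot" "(g \<longlongrightarrow> 1) at_top"
    and cd: "c < d" and le: "\<And>z. T c g z \<le> T d g z"
  shows False
proof -
  note Ng = N_profile[OF g(1)] and Nc = N_isCont[OF g(2)]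
  have le2: "S d (N g) (z - d * s) \<le> S c (N g) (z - c * s)" if "0 \<le> s" for z s
  proof -
    have "S d (N g) (z - d * s) \<le> S c (N g) (z - d * s)" using S_antimono_speed[OF Ng] cd by simp
    also have "\<dots> \<le> S c (N g) (z - c * s)"
      using mult_right_mono[of c d s] cd that by (intro profileD(2)[OF S_profile[OF Ng]]) simp
    finally show ?thesis .
  qed
  have "S c (N g) z \<le> S d (N g) z" for z
    using S_eq_imp_eq[OF S_profile[OF Ng] S_profile[OF Ng] S_isCont[OF Ng Nc] S_isCont[OF Ng Nc] le2 le[unfolded T_def], of 0]
    by simp
  moreover have "N g (z - d * s) \<le> N g (z - c * s)" if "0 \<le> s" for z s
    using mult_right_mono[of c d s] cd that by (intro profileD(2)[OF Ng]) simp
  ultimately have eq: "N g (z - d * t) = N g (z - c * t)" if "0 \<le> t" for z t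
    using S_eq_imp_eq[OF Ng Ng Nc Nc _ _ that] by blast
  from N_at_top[OF g(4)] have "(N g \<longlongrightarrow> 1) at_top" by simp
  from order_tendstoD(1)[OF this, of "1/2"] obtain y where y: "1 / 2 < N g y"
    by (auto simp: eventually_at_top_linorder)
  from N_at_bot[OF g(3)] have "(N g \<longlongrightarrow> 0) at_bot" by simp
  from order_tendstoD(2)[OF this, of "1/2"] obtain x where x: "\<And>z. z \<le> x \<Longrightarrow> N g z < 1 / 2"
    by (auto simp: eventually_at_bot_linorder)
  \<comment> \<open>The displacement \<open>(d - c) * t\<close> is then just large enough to carry
    \<open>y\<close> to \<open>x\<close> or further left.\<close>
  define t where "t = \<bar>y - x\<bar> / (d - c)"
  have t: "0 \<le> t" "(d - c) * t = \<bar>y - x\<bar>" using cd by (auto simp: t_def)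
  have "y + c * t - d * t \<le> x" using t(2) by (simp add: algebra_simps abs_if split: if_splits)
  then have "N g (y + c * t - d * t) < 1 / 2" by (rule x)
  moreover have "N g (y + c * t - d * t) = N g y" using eq[OF t(1), of "y + c * t"] by simp
  ultimately show False using y by simp
qed

lemma T_mono_countable:
  assumes "profile g" "profile h" "countable X" "\<And>y. y \<notin> X \<Longrightarrow> g y \<le> h y" "c \<noteq> 0"
  shows "T c g z \<le> T c h z"
proof -
  let ?Y = "X \<union> (\<lambda>x. x - 1) ` X \<union> (\<lambda>x. x + 1) ` X"
  have "N g y \<le> N h y" if y: "y \<notin> ?Y" for y
  proof (rule N_mono)
    have "y + 1 \<notin> X" using y by (metis UnCI add_diff_cancel_right' image_eqI)
    moreover have "y - 1 \<notin> X" using y by (metis UnCI diff_add_cancel image_eqI)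
    ultimately show "g y \<le> h y" "g (y + 1) \<le> h (y + 1)" "g (y - 1) \<le> h (y - 1)" using assms(4) y by auto
  qed
  moreover have "countable ?Y" using assms(3) by simp
  ultimately have "S c (N g) y \<le> S c (N h) y" for y
    using S_mono_countable[OF N_profile N_profile] assms by blast
  from S_mono[OF S_profile[OF N_profile[OF assms(1)]] S_profile[OF N_profile[OF assms(2)]] this]
  show ?thesis by (simp add: T_def)
qed

text \<open>A standing wave may be discontinuous and satisfies its equations only almost everywhere,
  hence the exceptional set when the speed vanishes.\<close>

definition wave :: "real \<Rightarrow> (real \<Rightarrow> real) \<Rightarrow> bool" where
  "wave c g \<longleftrightarrow> profile g \<and> (g \<longlongrightarrow> 0) at_bot \<and> (g \<longlongrightarrow> 1) at_top \<and>
    (\<exists>X. countable X \<and> (c \<noteq> 0 \<longrightarrow> X = {}) \<and> (\<forall>z. z \<notin> X \<longrightarrow> g z = T c g z))"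

lemma waveD:
  assumes "wave c g"
  shows "profile g" "(g \<longlongrightarrow> 0) at_bot" "(g \<longlongrightarrow> 1) at_top" "c \<noteq> 0 \<Longrightarrow> g z = T c g z" "c \<noteq> 0 \<Longrightarrow> isCont g z"
proof -
  show g: "profile g" "(g \<longlongrightarrow> 0) at_bot" "(g \<longlongrightarrow> 1) at_top" using assms by (auto simp: wave_def)
  show eq: "g z = T c g z" if "c \<noteq> 0" for z using assms that by (auto simp: wave_def)
  show "isCont g z" if "c \<noteq> 0"
  proof -
    have "g = T c g" using eq that by blast
    then show ?thesis using T_isCont[OF g(1) that] by metis
  qed
qed

text \<open>One application of \<open>T c\<close> turns a possibly discontinuous wave into a
  continuous subsolution or supersolution at the intermediate speed; the exceptional set disappears
  in the average.\<close>

lemma wave_smooth: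
  assumes "wave d g" and c: "c \<noteq> 0"
  shows "profile (T c g)" "isCont (T c g) z" "(T c g \<longlongrightarrow> 0) at_bot" "(T c g \<longlongrightarrow> 1) at_top"
    "c \<le> d \<Longrightarrow> T c g z \<le> T c (T c g) z" "d \<le> c \<Longrightarrow> T c (T c g) z \<le> T c g z"
proof -
  note g = waveD(1,2,3)[OF assms(1)]
  show "profile (T c g)" by (rule T_profile[OF g(1)])
  show "isCont (T c g) z" by (rule T_isCont[OF g(1) c])
  show "(T c g \<longlongrightarrow> 0) at_bot" using T_at_bot[OF g(1,2)] by simp
  show "(T c g \<longlongrightarrow> 1) at_top" using T_at_top[OF g(1,3)] by simp
  obtain X where X: "countable X" "\<And>z. z \<notin> X \<Longrightarrow> g z = T d g z" using assms(1) by (auto simp: wave_def)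
  show "T c g z \<le> T c (T c g) z" if "c \<le> d"
    by (rule T_mono_countable[OF g(1) T_profile[OF g(1)] X(1) _ c])
      (use X(2) T_antimono_speed[OF g(1) that] in metis)
  show "T c (T c g) z \<le> T c g z" if "d \<le> c"
    by (rule T_mono_countable[OF T_profile[OF g(1)] g(1) X(1) _ c])
      (use X(2) T_antimono_speed[OF g(1) that] in metis)
qed

text \<open>At most one speed vanishes. The wave of a nonzero speed enters directly, the other
  through \<open>T c\<close>; sliding identifies them up to translation, and the resulting
  inequality between two speeds is impossible.\<close>

lemma wave_speed_less_False:
  assumes g: "wave c1 g" and h: "wave c2 h" and less: "c1 < c2"
  shows False
proof -
  obtain c where c: "c1 < c" "c < c2" "c \<noteq> 0"
    using countable_dense[of "{0 :: real}" c1 c2] less by auto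
  show False
  proof (cases "c2 = 0")
    case False
    note h' = waveD[OF h] and hT = waveD(4)[OF h False]
    have sub: "h z \<le> T c h z" for z using T_antimono_speed[OF h'(1) less_imp_le[OF c(2)]] hT by metis
    obtain s where s: "\<And>z. h z = T c g (z + s)"
      by (rule sliding[OF h'(1) h'(5)[OF False] sub h'(2,3) wave_smooth(1,2,6,3,4)[OF g c(3)] c(3)])
        (use c in auto)
    have "T c h z \<le> T c2 h z" for z
    proof -
      have "h = (\<lambda>z. T c g (z + s))" using s by auto
      then have "T c h z = T c (T c g) (z + s)" by (simp only: T_shift)
      also have "\<dots> \<le> T c g (z + s)" by (rule wave_smooth(6)[OF g c(3)]) (use c in simp)
      finally show ?thesis using s hT by simp
    qed
    from two_speeds_False[OF h'(1) h'(5)[OF False] h'(2,3) c(2) this] show False .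
  next
    case True
    then have c1: "c1 \<noteq> 0" using less by simp
    note g' = waveD[OF g] and gT = waveD(4)[OF g c1]
    have super: "T c g z \<le> g z" for z using T_antimono_speed[OF g'(1) less_imp_le[OF c(1)]] gT by metis
    obtain s where s: "\<And>z. T c h z = g (z + s)"
      by (rule sliding[OF wave_smooth(1,2,5,3,4)[OF h c(3)] g'(1) g'(5)[OF c1] super g'(2,3) c(3)])
        (use c in auto)
    have "T c1 g z \<le> T c g z" for z
    proof -
      have "T c1 g z = T c h (z - s)" using s[of "z - s"] gT by simp
      also have "\<dots> \<le> T c (T c h) (z - s)" by (rule wave_smooth(5)[OF h c(3)]) (use c in simp)
      also have "T c h = (\<lambda>z. g (z + s))" using s by auto
      also have "T c (\<lambda>z. g (z + s)) (z - s) = T c g z" unfolding T_shift by simp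
      finally show ?thesis .
    qed
    from two_speeds_False[OF g'(1) g'(5)[OF c1] g'(2,3) c(1) this] show False .
  qed
qed

theorem wave_speed_unique: "wave c1 g \<Longrightarrow> wave c2 h \<Longrightarrow> c1 = c2"
  using wave_speed_less_False by (metis linorder_less_linear)

theorem wave_profile_unique:
  assumes g: "wave c g" and h: "wave c h" and c: "c \<noteq> 0"
  obtains a where "\<And>z. h z = g (z + a)"
  using sliding[OF waveD(1)[OF h] waveD(5)[OF h c] _ waveD(2,3)[OF h] waveD(1)[OF g] waveD(5)[OF g c] _ waveD(2,3)[OF g] c]
    waveD(4)[OF h c] waveD(4)[OF g c] by (metis order_refl)

end

subsection \<open>The differential equations\<close>

lemma AE_lebesgue_dense:
  assumes "AE z in lebesgue. P z" "a < (b :: real)"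
  obtains z where "a < z" "z < b" "P z"
proof -
  obtain Z where Z: "{z \<in> space lebesgue. \<not> P z} \<subseteq> Z" "emeasure lebesgue Z = 0" "Z \<in> sets lebesgue"
    by (rule AE_E[OF assms(1)])
  have "\<not> {a<..<b} \<subseteq> Z"
  proof
    assume "{a<..<b} \<subseteq> Z"
    then have "emeasure lebesgue {a<..<b} \<le> emeasure lebesgue Z" using Z(3) by (rule emeasure_mono)
    moreover have "emeasure lebesgue {a<..<b} = ennreal (b - a)" using assms(2) by simp
    ultimately show False using Z(2) assms(2) by simp
  qed
  then obtain z where "z \<in> {a<..<b}" "z \<notin> Z" by blast
  then show ?thesis using Z(1) that by auto
qed

context bistable_chain
begin

lemma alpha_N: "\<alpha> * N g z = \<alpha> * g z + 2 * (g (z + 1) + g (z - 1) - 2 * g z + f (g z))"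
  using alpha_pos by (simp add: N_def field_simps)

text \<open>For nonzero speed both equations are solved by the unique bounded averages. For
  \<open>c = 0\<close> the first gives equality of the two components and the second becomes the
  standing equation, first almost everywhere and then off the discontinuities.\<close>

lemma traveling_wave_imp_wave:
  assumes f: "f = f_L L" and tw: "traveling_wave L \<alpha> c \<phi>\<^sub>1 \<phi>\<^sub>2"
  shows "wave c \<phi>\<^sub>1" "c \<noteq> 0 \<Longrightarrow> \<phi>\<^sub>2 z = S c (N \<phi>\<^sub>1) z"
proof -
  have lim: "(\<phi>\<^sub>1 \<longlongrightarrow> 0) at_bot" "(\<phi>\<^sub>1 \<longlongrightarrow> 1) at_top"
    and p1: "profile \<phi>\<^sub>1" and p2: "profile \<phi>\<^sub>2"
    using tw by (auto simp: traveling_wave_def intro!: mono_limits_profile)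
  have eqs: "wave c \<phi>\<^sub>1 \<and> (\<forall>z. \<phi>\<^sub>2 z = S c (N \<phi>\<^sub>1) z)" if c: "c \<noteq> 0"
  proof -
    have d: "(\<phi>\<^sub>1 has_real_derivative deriv \<phi>\<^sub>1 z) (at z)" "(\<phi>\<^sub>2 has_real_derivative deriv \<phi>\<^sub>2 z) (at z)"
      and eq: "wave_equations L \<alpha> c \<phi>\<^sub>1 \<phi>\<^sub>2 z" for z
      using tw c by (auto simp: traveling_wave_def field_differentiable_derivI)
    have "deriv \<phi>\<^sub>1 z = \<alpha> / c * (\<phi>\<^sub>2 z - \<phi>\<^sub>1 z)" for z
      using eq[of z] c by (simp add: wave_equations_def field_simps)
    then have d1: "(\<phi>\<^sub>1 has_real_derivative \<alpha> / c * (\<phi>\<^sub>2 z - \<phi>\<^sub>1 z)) (at z)" for z using d(1)[of z] by simp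
    have "deriv \<phi>\<^sub>2 z = \<alpha> / c * (N \<phi>\<^sub>1 z - \<phi>\<^sub>2 z)" for z
    proof -
      have "c * deriv \<phi>\<^sub>2 z = \<alpha> * N \<phi>\<^sub>1 z - \<alpha> * \<phi>\<^sub>2 z"
        using eq[of z] unfolding alpha_N by (simp add: wave_equations_def f algebra_simps)
      then show ?thesis using c by (simp add: field_simps)
    qed
    then have d2: "(\<phi>\<^sub>2 has_real_derivative \<alpha> / c * (N \<phi>\<^sub>1 z - \<phi>\<^sub>2 z)) (at z)" for z using d(2)[of z] by simp
    have c1: "isCont \<phi>\<^sub>1 z" and c2: "isCont \<phi>\<^sub>2 z" for z using d DERIV_isCont by blast+
    have 1: "\<phi>\<^sub>1 z = S c \<phi>\<^sub>2 z" for z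
      by (rule S_unique[OF p2 c2 c profileD(3,4)[OF p1] d1])
    have 2: "\<phi>\<^sub>2 z = S c (N \<phi>\<^sub>1) z" for z
      by (rule S_unique[OF N_profile[OF p1] N_isCont[OF c1] c profileD(3,4)[OF p2] d2])
    then have "\<phi>\<^sub>2 = S c (N \<phi>\<^sub>1)" by blast
    then have "\<phi>\<^sub>1 z = T c \<phi>\<^sub>1 z" for z using 1[of z] by (simp add: T_def)
    then show ?thesis using 2 p1 lim by (auto simp: wave_def intro!: exI[of _ "{}"])
  qed
  then show "c \<noteq> 0 \<Longrightarrow> \<phi>\<^sub>2 z = S c (N \<phi>\<^sub>1) z" by blast
  show "wave c \<phi>\<^sub>1"
  proof (cases "c = 0")
    case True
    then have ae: "AE z in lebesgue. wave_equations L \<alpha> 0 \<phi>\<^sub>1 \<phi>\<^sub>2 z" using tw by (simp add: traveling_wave_def)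
    have good: "N \<phi>\<^sub>1 z = \<phi>\<^sub>1 z" if "wave_equations L \<alpha> 0 \<phi>\<^sub>1 \<phi>\<^sub>2 z" for z
    proof -
      have "\<phi>\<^sub>1 (z + 1) + \<phi>\<^sub>1 (z - 1) - 2 * \<phi>\<^sub>1 z + f (\<phi>\<^sub>1 z) = 0"
        using that alpha_pos by (auto simp: wave_equations_def f)
      then show ?thesis unfolding N_def by simp
    qed
    let ?X = "{z. \<not> isCont \<phi>\<^sub>1 z} \<union> {z. \<not> isCont (N \<phi>\<^sub>1) z}"
    have X: "countable ?X" using profile_discont[OF p1] profile_discont[OF N_profile[OF p1]] by simp
    have "\<phi>\<^sub>1 z = T c \<phi>\<^sub>1 z" if z: "z \<notin> ?X" for z
    proof (rule ccontr)
      define k where "k y = N \<phi>\<^sub>1 y - \<phi>\<^sub>1 y" for y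
      assume "\<phi>\<^sub>1 z \<noteq> T c \<phi>\<^sub>1 z"
      then have "k z \<noteq> 0" using True by (simp add: T_zero k_def)
      moreover have "isCont k z" unfolding k_def using z by (intro isCont_diff) auto
      \<comment> \<open>A defect at a common continuity point would persist on an interval, which
        must contain a point where the equations hold.\<close>
      ultimately have "\<forall>\<^sub>F y in at z. k y \<noteq> 0" unfolding isCont_def by (intro tendsto_imp_eventually_ne)
      then obtain e where e: "0 < e" "\<And>y. y \<noteq> z \<Longrightarrow> dist y z < e \<Longrightarrow> k y \<noteq> 0" by (auto simp: eventually_at)
      obtain y where "z < y" "y < z + e" "wave_equations L \<alpha> 0 \<phi>\<^sub>1 \<phi>\<^sub>2 y"
        by (rule AE_lebesgue_dense[OF ae, of z "z + e"]) (use e in auto)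
      then show False using e(2)[of y] good[of y] by (simp add: k_def dist_real_def)
    qed
    then show ?thesis unfolding wave_def using True X p1 lim by blast
  qed (use eqs in blast)
qed

lemma wave_imp_traveling_wave:
  assumes f: "f = f_L L" and g: "profile g" "g = T c g" "(g \<longlongrightarrow> 0) at_bot" "(g \<longlongrightarrow> 1) at_top"
  shows "traveling_wave L \<alpha> c g (S c (N g))"
proof -
  let ?h = "S c (N g)"
  have h: "profile ?h" by (rule S_profile[OF N_profile[OF g(1)]])
  have gh: "g = S c ?h" using g(2) by (simp add: T_def)
  have "((N g) \<longlongrightarrow> 0) at_bot" "((N g) \<longlongrightarrow> 1) at_top" using N_at_bot[OF g(3)] N_at_top[OF g(4)] by simp_all
  then have lims: "(?h \<longlongrightarrow> 0) at_bot" "(?h \<longlongrightarrow> 1) at_top"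
    using S_at_bot[OF N_profile[OF g(1)]] S_at_top[OF N_profile[OF g(1)]] by blast+
  have eqn: "wave_equations L \<alpha> c g ?h z"
    if "c * deriv g z = \<alpha> * (?h z - g z)" "c * deriv ?h z = \<alpha> * (N g z - ?h z)" for z
    using that alpha_N[of g z] by (simp add: wave_equations_def f algebra_simps)
  have "g field_differentiable (at z) \<and> ?h field_differentiable (at z) \<and> wave_equations L \<alpha> c g ?h z"
    if c: "c \<noteq> 0" for z
  proof -
    have gC: "isCont g z" for z using T_isCont[OF g(1) c] g(2) by metis
    have hC: "isCont ?h z" for z by (rule S_continuous[OF N_profile[OF g(1)] c])
    have "(S c ?h has_real_derivative \<alpha> / c * (?h z - S c ?h z)) (at z)"
      by (rule S_deriv[OF h hC c])
    then have d1: "(g has_real_derivative \<alpha> / c * (?h z - g z)) (at z)" unfolding gh[symmetric] .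
    have d2: "(?h has_real_derivative \<alpha> / c * (N g z - ?h z)) (at z)"
      by (rule S_deriv[OF N_profile[OF g(1)] N_isCont[OF gC] c])
    show ?thesis
      using d1 d2 c DERIV_imp_deriv[OF d1] DERIV_imp_deriv[OF d2]
      by (intro conjI eqn) (auto simp: field_differentiable_def)
  qed
  moreover have "wave_equations L \<alpha> c g ?h z" if "c = 0" for z
  proof -
    have "N g = g" using g(2) that by (simp add: T_zero)
    then show ?thesis using that by (intro eqn) auto
  qed
  ultimately show ?thesis using g h lims by (auto simp: traveling_wave_def profile_def)
qed

lemma traveling_wave_well_posed:
  assumes f: "f = f_L L"
  shows "(\<exists>!c. \<exists>\<phi>\<^sub>1 \<phi>\<^sub>2. traveling_wave L \<alpha> c \<phi>\<^sub>1 \<phi>\<^sub>2) \<and>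
      (\<forall>c \<phi>\<^sub>1 \<phi>\<^sub>2 \<psi>\<^sub>1 \<psi>\<^sub>2.
         c \<noteq> 0 \<and> traveling_wave L \<alpha> c \<phi>\<^sub>1 \<phi>\<^sub>2 \<and> traveling_wave L \<alpha> c \<psi>\<^sub>1 \<psi>\<^sub>2 \<longrightarrow>
         (\<exists>a. \<forall>z. \<psi>\<^sub>1 z = \<phi>\<^sub>1 (z + a) \<and> \<psi>\<^sub>2 z = \<phi>\<^sub>2 (z + a)))"
proof (intro conjI allI impI)
  show "\<exists>!c. \<exists>\<phi>\<^sub>1 \<phi>\<^sub>2. traveling_wave L \<alpha> c \<phi>\<^sub>1 \<phi>\<^sub>2"
  proof (rule ex_ex1I)
    show "\<exists>c \<phi>\<^sub>1 \<phi>\<^sub>2. traveling_wave L \<alpha> c \<phi>\<^sub>1 \<phi>\<^sub>2"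
      using wave_exists wave_imp_traveling_wave[OF f] by blast
    show "c = d" if "\<exists>\<phi>\<^sub>1 \<phi>\<^sub>2. traveling_wave L \<alpha> c \<phi>\<^sub>1 \<phi>\<^sub>2" "\<exists>\<phi>\<^sub>1 \<phi>\<^sub>2. traveling_wave L \<alpha> d \<phi>\<^sub>1 \<phi>\<^sub>2" for c d
      using that traveling_wave_imp_wave(1)[OF f] wave_speed_unique by blast
  qed
  fix c \<phi>\<^sub>1 \<phi>\<^sub>2 \<psi>\<^sub>1 \<psi>\<^sub>2
  assume "c \<noteq> 0 \<and> traveling_wave L \<alpha> c \<phi>\<^sub>1 \<phi>\<^sub>2 \<and> traveling_wave L \<alpha> c \<psi>\<^sub>1 \<psi>\<^sub>2"
  then have c: "c \<noteq> 0" and tw: "traveling_wave L \<alpha> c \<phi>\<^sub>1 \<phi>\<^sub>2" "traveling_wave L \<alpha> c \<psi>\<^sub>1 \<psi>\<^sub>2" by auto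
  note \<phi> = traveling_wave_imp_wave[OF f tw(1)] and \<psi> = traveling_wave_imp_wave[OF f tw(2)]
  obtain a where a: "\<And>z. \<psi>\<^sub>1 z = \<phi>\<^sub>1 (z + a)" by (rule wave_profile_unique[OF \<phi>(1) \<psi>(1) c]) blast
  have "\<psi>\<^sub>2 z = \<phi>\<^sub>2 (z + a)" for z
  proof -
    have "\<psi>\<^sub>1 = (\<lambda>y. \<phi>\<^sub>1 (y + a))" using a by auto
    then have "N \<psi>\<^sub>1 y = N \<phi>\<^sub>1 (y + a)" for y by (simp only: N_shift)
    then have "N \<psi>\<^sub>1 = (\<lambda>y. N \<phi>\<^sub>1 (y + a))" by blast
    then have "S c (N \<psi>\<^sub>1) z = S c (N \<phi>\<^sub>1) (z + a)" by (simp only: S_shift)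
    then show ?thesis using \<phi>(2)[OF c] \<psi>(2)[OF c] by simp
  qed
  then show "\<exists>a. \<forall>z. \<psi>\<^sub>1 z = \<phi>\<^sub>1 (z + a) \<and> \<psi>\<^sub>2 z = \<phi>\<^sub>2 (z + a)" using a by blast
qed

end

section \<open>The sine nonlinearity\<close>

text \<open>The product form shows the zeros and signs at once: the sine factor is positive on
  (0,1), so the cosine factor decides the sign there.\<close>

lemma f_L_product: "f_L L v = - 2 * sin (pi * v) * cos (pi * v - 2 * pi * L)"
proof -
  have "sin (2 * pi * (v - L)) + sin (2 * pi * L)
      = 2 * sin ((2 * pi * (v - L) + 2 * pi * L) / 2) * cos ((2 * pi * (v - L) - 2 * pi * L) / 2)"
    by (rule sin_plus_sin)
  moreover have "(2 * pi * (v - L) + 2 * pi * L) / 2 = pi * v" by (simp add: field_simps)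
  moreover have "(2 * pi * (v - L) - 2 * pi * L) / 2 = pi * v - 2 * pi * L" by (simp add: field_simps)
  ultimately show ?thesis by (simp add: f_L_def)
qed

lemma f_L_deriv: "(f_L L has_real_derivative - 2 * pi * cos (2 * pi * (v - L))) (at v)"
  unfolding f_L_def[abs_def] by (auto intro!: derivative_eq_intros)

lemma sin_lipschitz: "\<bar>sin x - sin y\<bar> \<le> \<bar>x - y\<bar>" for x y :: real
proof -
  have "\<bar>sin x - sin y\<bar> = 2 * \<bar>sin ((x - y) / 2)\<bar> * \<bar>cos ((x + y) / 2)\<bar>"
    by (simp add: sin_diff_sin abs_mult)
  also have "\<dots> \<le> 2 * \<bar>sin ((x - y) / 2)\<bar> * 1" by (intro mult_left_mono) auto
  also have "\<dots> \<le> 2 * \<bar>(x - y) / 2\<bar>" using abs_sin_x_le_abs_x[of "(x - y) / 2"] by simp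
  finally show ?thesis by simp
qed

lemma f_L_lipschitz: "\<bar>f_L L x - f_L L y\<bar> \<le> 2 * pi * \<bar>x - y\<bar>"
proof -
  have "\<bar>f_L L x - f_L L y\<bar> = \<bar>sin (2 * pi * (x - L)) - sin (2 * pi * (y - L))\<bar>"
    by (simp add: f_L_def abs_minus_commute)
  also have "\<dots> \<le> \<bar>2 * pi * (x - L) - 2 * pi * (y - L)\<bar>" by (rule sin_lipschitz)
  also have "2 * pi * (x - L) - 2 * pi * (y - L) = 2 * pi * (x - y)" by (simp add: algebra_simps)
  finally show ?thesis by (simp add: abs_mult)
qed

lemma f_L_periodic: "f_L L (v + 1) = f_L L v"
proof -
  have "2 * pi * (v + 1 - L) = 2 * pi * (v - L) + 2 * pi" by (simp add: algebra_simps)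
  then show ?thesis by (simp add: f_L_def)
qed

text \<open>After reduction of \<open>L\<close> modulo 1 to \<open>\<bar>l\<bar> < 1 / 4\<close>,
  the cosine factor changes sign exactly once in (0,1). Near 0 the derivative is bounded away from
  zero by continuity, and periodicity transfers this to 1.\<close>

lemma f_L_bistable:
  assumes "cos (2 * pi * L) > 0" "4 + 4 * pi < \<alpha>"
  shows "\<exists>\<theta> \<delta> \<mu>. bistable_chain \<alpha> (f_L L) \<theta> (2 * pi) \<delta> \<mu>"
proof -
  define l where "l = L - of_int (round L)"
  have shift: "cos (x + 2 * pi * L) = cos (x + 2 * pi * l)" "cos (x - 2 * pi * L) = cos (x - 2 * pi * l)" for x
  proof -
    have "x + 2 * pi * L = x + 2 * pi * l + 2 * pi * of_int (round L)"
      "x - 2 * pi * L = x - 2 * pi * l + 2 * pi * of_int (- round L)" by (simp_all add: l_def algebra_simps)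
    then show "cos (x + 2 * pi * L) = cos (x + 2 * pi * l)" "cos (x - 2 * pi * L) = cos (x - 2 * pi * l)"
      using sin_cos_eq_iff by blast+
  qed
  have cl: "0 < cos (2 * pi * l)" using assms(1) shift(1)[of 0] by simp
  have "\<bar>l\<bar> \<le> 1 / 2" using of_int_round_abs_le[of L] by (simp add: l_def abs_minus_commute)
  have l: "\<bar>l\<bar> < 1 / 4"
  proof (rule ccontr)
    assume "\<not> \<bar>l\<bar> < 1 / 4"
    then have b: "pi / 2 \<le> 2 * pi * \<bar>l\<bar>" "2 * pi * \<bar>l\<bar> \<le> pi" using \<open>\<bar>l\<bar> \<le> 1 / 2\<close> by (auto simp: field_simps)
    have "cos (2 * pi * \<bar>l\<bar>) \<le> cos (pi / 2)" using b by (intro cos_monotone_0_pi_le) auto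
    moreover have "cos (2 * pi * \<bar>l\<bar>) = cos (2 * pi * l)" by (cases "0 \<le> l") auto
    ultimately show False using cl by simp
  qed
  \<comment> \<open>Here the argument of the cosine factor equals \<open>pi / 2\<close>.\<close>
  define \<theta> where "\<theta> = 1 / 2 + 2 * l"
  have th: "0 < \<theta>" "\<theta> < 1" using l by (auto simp: \<theta>_def abs_if split: if_splits)
  have fl: "f_L L v = - 2 * sin (pi * v) * cos (pi * v - 2 * pi * l)" for v
    by (simp only: f_L_product shift(2))
  have pi_th: "pi * \<theta> - 2 * pi * l = pi / 2" by (simp add: \<theta>_def algebra_simps)
  have pl: "\<bar>2 * pi * l\<bar> < pi / 2" using l by (simp add: abs_mult)
  have neg: "f_L L v < 0" if v: "0 < v" "v < \<theta>" for v
  proof -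
    have *: "0 < pi * v" "pi * v < pi * \<theta>" "pi * v < pi * 1" using v th by (auto intro!: mult_strict_left_mono)
    then have "0 < sin (pi * v)" by (auto intro!: sin_gt_zero)
    moreover have "0 < cos (pi * v - 2 * pi * l)"
      using * pl pi_th by (intro cos_gt_zero_pi) linarith+
    ultimately show ?thesis unfolding fl by (simp add: mult_pos_pos)
  qed
  have pos: "0 < f_L L v" if v: "\<theta> < v" "v < 1" for v
  proof -
    have *: "0 < pi * v" "pi * \<theta> < pi * v" "pi * v < pi * 1" using v th by (auto intro!: mult_strict_left_mono mult_pos_pos)
    then have "0 < sin (pi * v)" by (auto intro!: sin_gt_zero)
    moreover have "0 < cos (pi * v - 2 * pi * l - pi)"
      using * pl pi_th by (intro cos_gt_zero_pi) linarith+
    then have "cos (pi * v - 2 * pi * l) < 0" by (simp add: cos_diff)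
    ultimately show ?thesis unfolding fl by (simp add: mult_pos_neg)
  qed
  \<comment> \<open>Half of the decay rate \<open>2 * pi * cos (2 * pi * L)\<close> of
    \<open>f_L L\<close> at 0, so that it persists on a neighbourhood.\<close>
  define \<mu> where "\<mu> = pi * cos (2 * pi * L)"
  have mu: "0 < \<mu>" using assms(1) by (simp add: \<mu>_def)
  have "isCont (\<lambda>v. cos (2 * pi * (v - L))) 0" by (intro continuous_intros)
  then have "((\<lambda>v. cos (2 * pi * (v - L))) \<longlongrightarrow> cos (2 * pi * L)) (at 0)" by (simp add: isCont_def)
  moreover have "cos (2 * pi * L) / 2 < cos (2 * pi * L)" using assms(1) by simp
  ultimately have "\<forall>\<^sub>F v in at 0. cos (2 * pi * L) / 2 < cos (2 * pi * (v - L))" by (rule order_tendstoD(1))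
  then obtain d where d: "0 < d" "\<And>v. v \<noteq> 0 \<Longrightarrow> dist v 0 < d \<Longrightarrow> cos (2 * pi * L) / 2 < cos (2 * pi * (v - L))"
    by (auto simp: eventually_at)
  define \<delta> where "\<delta> = d / 2"
  have cosd: "cos (2 * pi * L) / 2 \<le> cos (2 * pi * (v - L))" if "\<bar>v\<bar> \<le> \<delta>" for v
    using d(1) d(2)[of v] that assms(1) by (cases "v = 0") (auto simp: \<delta>_def)
  have stable: "f_L L y - f_L L x \<le> - \<mu> * (y - x)" if xy: "- \<delta> \<le> x" "x \<le> y" "y \<le> \<delta>" for x y
  proof -
    have "f_L L y + \<mu> * y \<le> f_L L x + \<mu> * x"
    proof (rule DERIV_nonpos_imp_nonincreasing[OF xy(2)])
      fix v assume v: "x \<le> v" "v \<le> y"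
      have "((\<lambda>v. f_L L v + \<mu> * v) has_real_derivative - 2 * pi * cos (2 * pi * (v - L)) + \<mu>) (at v)"
        by (rule derivative_eq_intros f_L_deriv refl)+ simp
      moreover have "- 2 * pi * cos (2 * pi * (v - L)) + \<mu> \<le> 0"
      proof -
        have "2 * pi * (cos (2 * pi * L) / 2) \<le> 2 * pi * cos (2 * pi * (v - L))"
          using xy v by (intro mult_left_mono cosd) auto
        then show ?thesis by (simp add: \<mu>_def)
      qed
      ultimately show "\<exists>D. ((\<lambda>v. f_L L v + \<mu> * v) has_real_derivative D) (at v) \<and> D \<le> 0" by blast
    qed
    then show ?thesis by (simp add: algebra_simps)
  qed
  have "bistable_chain \<alpha> (f_L L) \<theta> (2 * pi) \<delta> \<mu>"
  proof unfold_locales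
    have "0 < pi" by simp
    then show "0 < \<alpha>" "4 + 2 * (2 * pi) < \<alpha>" using assms(2) by linarith+
    show "f_L L 0 = 0" "f_L L 1 = 0" "f_L L \<theta> = 0" unfolding fl by (simp_all add: pi_th)
    show "f_L L y - f_L L x \<le> - \<mu> * (y - x)" if "0 \<le> x" "x \<le> y" "y \<le> \<delta>" for x y
      using stable[of x y] that d(1) by (simp add: \<delta>_def)
    show "f_L L y - f_L L x \<le> - \<mu> * (y - x)" if "1 - \<delta> \<le> x" "x \<le> y" "y \<le> 1" for x y
      using stable[of "x - 1" "y - 1"] that d(1) f_L_periodic[of L "x - 1"] f_L_periodic[of L "y - 1"]
      by (simp add: \<delta>_def)
  qed (use th neg pos mu d(1) f_L_lipschitz in \<open>auto simp: \<delta>_def\<close>)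
  then show ?thesis by blast
qed

lemma monotonicity_condition_large:
  assumes "4 + 4 * pi < \<alpha>" shows "monotonicity_condition L \<alpha>"
  unfolding monotonicity_condition_def
proof (intro ballI)
  fix x0 x1 x2 :: real
  have "((\<lambda>x. FK_nonlinearity L x x1 x2) has_real_derivative - 2 + - 2 * pi * cos (2 * pi * (x0 - L))) (at x0)"
    unfolding FK_nonlinearity_def by (rule derivative_eq_intros f_L_deriv refl)+ simp
  then have "deriv (\<lambda>x. FK_nonlinearity L x x1 x2) x0 = - 2 + - 2 * pi * cos (2 * pi * (x0 - L))"
    by (rule DERIV_imp_deriv)
  moreover have "pi * cos (2 * pi * (x0 - L)) \<le> pi" by (simp add: mult_left_le)
  ultimately show "0 < 2 * deriv (\<lambda>x. FK_nonlinearity L x x1 x2) x0 + \<alpha>" using assms by linarith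
qed

theorem theorem1p1:
  fixes L :: real
  assumes bistable: "cos (2 * pi * L) > 0"
  shows "\<exists>\<alpha>star>0.
           (\<forall>\<alpha>\<^sub>0\<ge>\<alpha>star. monotonicity_condition L \<alpha>\<^sub>0) \<and>
           (\<forall>\<alpha>\<^sub>0\<ge>\<alpha>star.
              (\<exists>!c. \<exists>\<phi>\<^sub>1 \<phi>\<^sub>2. traveling_wave L \<alpha>\<^sub>0 c \<phi>\<^sub>1 \<phi>\<^sub>2) \<and>
              (\<forall>c \<phi>\<^sub>1 \<phi>\<^sub>2 \<psi>\<^sub>1 \<psi>\<^sub>2.
                 c \<noteq> 0 \<and> traveling_wave L \<alpha>\<^sub>0 c \<phi>\<^sub>1 \<phi>\<^sub>2 \<and> traveling_wave L \<alpha>\<^sub>0 c \<psi>\<^sub>1 \<psi>\<^sub>2 \<longrightarrow>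
                 (\<exists>a. \<forall>z. \<psi>\<^sub>1 z = \<phi>\<^sub>1 (z + a) \<and> \<psi>\<^sub>2 z = \<phi>\<^sub>2 (z + a))))"
proof -
  let "\<exists>\<alpha>star>0. _ \<and> (\<forall>\<alpha>\<^sub>0\<ge>\<alpha>star. ?well_posed \<alpha>\<^sub>0)" = ?thesis
  have well_posed: "?well_posed \<alpha>" if large: "4 + 4 * pi < \<alpha>" for \<alpha>
  proof -
    obtain \<theta> \<delta> \<mu> where "bistable_chain \<alpha> (f_L L) \<theta> (2 * pi) \<delta> \<mu>"
      using f_L_bistable[OF bistable large] by blast
    from bistable_chain.traveling_wave_well_posed[OF this refl] show ?thesis .
  qed
  \<comment> \<open>The value \<open>5 + 4 * pi\<close> lies above \<open>4 + 2 * B\<close> with the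
    Lipschitz constant \<open>B = 2 * pi\<close>, and above the bound \<open>4 + 4 * pi\<close> that
    yields the monotonicity condition.\<close>
  have "\<forall>\<alpha>\<^sub>0\<ge>5 + 4 * pi. ?well_posed \<alpha>\<^sub>0" by (intro allI impI well_posed) simp
  moreover have "\<forall>\<alpha>\<^sub>0\<ge>5 + 4 * pi. monotonicity_condition L \<alpha>\<^sub>0"
    by (intro allI impI monotonicity_condition_large) simp
  moreover have "0 < 5 + 4 * pi" by (simp add: add_pos_pos)
  ultimately show ?thesis by (intro exI[of _ "5 + 4 * pi"] conjI)
qed

end
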